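(* Let $E=E_0\oplus E_1\to M$ be a supervector bundle over a smooth manifold $M$, and let $\boldsymbol{\nabla}$ be a graded connection on the graded vector bundle $\mathcal{L}=\Omega(M)\otimes\Gamma(E)$ over the Cartan-Koszul supermanifold $(M,\Omega(M))$. Then the operator $D^{\boldsymbol{\nabla}}:\Omega(M;E)\to\Omega(M;E)$ defined by $D^{\boldsymbol{\nabla}}(\alpha\otimes\phi)=\boldsymbol{\nabla}_{\mathrm{d}}(\alpha\phi)$, for $\alpha\in\Omega(M)$ and $\phi\in\Gamma(E)$, is a Quillen superconnection on $E$.
   Context: The ground field is $\mathbb{R}$. $\Omega(M)=\Gamma(\Lambda T^*M)$ is the algebra of differential forms on $M$, with exterior differential $\mathrm{d}$. $\mathrm{Der}\,\Omega(M)$ is the $\Omega(M)$-module of graded derivations of $\Omega(M)$: spanned by homogeneous $\mathbb{R}$-linear maps $\delta$ with $\delta(\alpha\beta)=\delta(\alpha)\beta+(-1)^{|\alpha||\delta|}\alpha\,\delta(\beta)$; in particular $\mathrm{d}\in\mathrm{Der}\,\Omega(M)$, with $|\mathrm{d}|=1$. The Cartan-Koszul supermanifold $(M,\Omega(M))$ has $\Omega(M)$ as its (sheaf of) superfunctions. A supervector bundle $E=E_0\oplus E_1\to M$ is a $\mathbb{Z}_2$-graded real vector bundle. $\Omega(M;E)=\Omega(M)\otimes_{C^\infty(M)}\Gamma(E)$ is the space of $E$-valued forms, with total $\mathbb{Z}_2$-degree $|\alpha\otimes\phi|=|\alpha|+|\phi|$ mod $2$. It is identified with the graded vector bundle (locally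 free $\mathbb{Z}_2$-graded $\Omega(M)$-module) $\mathcal{L}=\Omega(M)\otimes\Gamma(E)$ over $(M,\Omega(M))$, writing $\alpha\phi$ for $\alpha\otimes\phi$. A graded connection on $\mathcal{L}$ is an even morphism of left $\Omega(M)$-modules $\boldsymbol{\nabla}:\mathrm{Der}\,\Omega(M)\to\mathrm{End}_{\mathbb{R}}(\mathcal{L})$, $\delta\mapsto\boldsymbol{\nabla}_\delta$, such that $\boldsymbol{\nabla}_\delta(\alpha\phi)=\delta(\alpha)\phi+(-1)^{|\alpha||\delta|}\alpha\boldsymbol{\nabla}_\delta\phi$ for homogeneous $\delta\in\mathrm{Der}\,\Omega(M)$, $\alpha\in\Omega(M)$, and $\phi\in\mathcal{L}$. A Quillen superconnection on $E$ is an $\mathbb{R}$-linear operator $D$ on $\Omega(M;E)$ of odd total degree such that $D(\alpha\wedge\sigma)=\mathrm{d}\alpha\wedge\sigma+(-1)^{|\alpha|}\alpha\wedge D\sigma$ for all homogeneous $\alpha\in\Omega(M)$ and all $\sigma\in\Omega(M;E)$. *)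

theory Defs
  imports
    "HOL-Analysis.Analysis"
    "HOL-Algebra.Module"
    "HOL-Algebra.Free_Abelian_Groups"
    "HOL-Library.Z2"
begin

section \<open>Smooth maps and smooth manifolds\<close>

text \<open>
  The model space of a manifold is a linear subspace \<open>V\<close> of a Euclidean space, so that the
  dimension \<open>dim V\<close> is an arbitrary natural number, \<open>0\<close> included.  Accordingly derivatives are
  taken within \<open>V\<close>: for \<open>x\<close> in a relatively open \<open>W \<subseteq> V\<close> and \<open>v \<in> V\<close> the value
  \<open>frechet_derivative f (at x within V) v\<close> does not depend on the values of \<open>f\<close> outside \<open>W\<close>,
  nor on the choice of derivative in the definition of \<open>frechet_derivative\<close>.
\<close>

primrec Ck_on ::
  "nat \<Rightarrow> 'a::euclidean_space set \<Rightarrow> 'a set \<Rightarrow> ('a \<Rightarrow> 'b::euclidean_space) \<Rightarrow> bool" where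
  "Ck_on 0 V W f \<longleftrightarrow> continuous_on W f"
| "Ck_on (Suc k) V W f \<longleftrightarrow>
     (\<forall>x\<in>W. f differentiable (at x within V)) \<and>
     (\<forall>v\<in>V. Ck_on k V W (\<lambda>x. frechet_derivative f (at x within V) v))"

definition smooth_on :: "'a::euclidean_space set \<Rightarrow> 'a set \<Rightarrow> ('a \<Rightarrow> 'b::euclidean_space) \<Rightarrow> bool" where
  "smooth_on V W f \<longleftrightarrow> (\<forall>k. Ck_on k V W f)"

text \<open>A chart is a pair of its domain and its coordinate map.\<close>

type_synonym ('m, 'a) chart = "'m set \<times> ('m \<Rightarrow> 'a)"

record ('m, 'a) manifold =
  mtop :: "'m topology"
  model :: "'a set"
  atlas :: "('m, 'a) chart set"

abbreviation points :: "('m, 'a, 'z) manifold_scheme \<Rightarrow> 'm set" where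
  "points M \<equiv> topspace (mtop M)"

definition chart_inv :: "('m, 'a) chart \<Rightarrow> 'a \<Rightarrow> 'm" where
  "chart_inv c = inv_into (fst c) (snd c)"

definition smooth_manifold :: "('m, 'a::euclidean_space) manifold \<Rightarrow> bool" where
  "smooth_manifold M \<longleftrightarrow>
     Hausdorff_space (mtop M) \<and> second_countable (mtop M) \<and> subspace (model M) \<and>
     (\<Union>c\<in>atlas M. fst c) = points M \<and>
     (\<forall>c\<in>atlas M.
        openin (mtop M) (fst c) \<and>
        openin (top_of_set (model M)) (snd c ` fst c) \<and>
        homeomorphic_map (subtopology (mtop M) (fst c)) (top_of_set (snd c ` fst c)) (snd c)) \<and>
     (\<forall>c\<in>atlas M. \<forall>c'\<in>atlas M.
        smooth_on (model M) (snd c ` (fst c \<inter> fst c')) (snd c' \<circ> chart_inv c))"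

definition manifold_smooth_on ::
  "('m, 'a::euclidean_space) manifold \<Rightarrow> 'm set \<Rightarrow> ('m \<Rightarrow> 'b::euclidean_space) \<Rightarrow> bool" where
  "manifold_smooth_on M W g \<longleftrightarrow>
     (\<forall>c\<in>atlas M. smooth_on (model M) (snd c ` (fst c \<inter> W)) (g \<circ> chart_inv c))"

text \<open>
  The ring \<open>C\<^sup>\<infinity>(M)\<close>.  Functions (and below, forms) are total on the type \<open>'m\<close>, hence are
  required to vanish outside their domain of definition.
\<close>

definition Cinf :: "('m, 'a::euclidean_space) manifold \<Rightarrow> ('m \<Rightarrow> real) ring" where
  "Cinf M = \<lparr>carrier = {f. manifold_smooth_on M (points M) f \<and> (\<forall>p. p \<notin> points M \<longrightarrow> f p = 0)},
     monoid.mult = (\<lambda>f g p. f p * g p),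
     one = (\<lambda>p. if p \<in> points M then 1 else 0),
     ring.zero = (\<lambda>p. 0),
     add = (\<lambda>f g p. f p + g p)\<rparr>"

section \<open>Tangent vectors and differential forms\<close>

text \<open>
  A tangent vector at \<open>p\<close> is a family of coordinate vectors, one for each chart around \<open>p\<close>, that
  transforms by the derivatives of the coordinate changes (and is \<open>0\<close> at the irrelevant charts).
\<close>

type_synonym ('m, 'a) tvec = "('m, 'a) chart \<Rightarrow> 'a"

definition transition_deriv ::
  "('m, 'a::euclidean_space) manifold \<Rightarrow> 'm \<Rightarrow> ('m, 'a) chart \<Rightarrow> ('m, 'a) chart \<Rightarrow> 'a \<Rightarrow> 'a" where
  "transition_deriv M p c c' =
     frechet_derivative (snd c' \<circ> chart_inv c) (at (snd c p) within model M)"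

definition tangent_space ::
  "('m, 'a::euclidean_space) manifold \<Rightarrow> 'm \<Rightarrow> ('m, 'a) tvec set" where
  "tangent_space M p = {v.
     (\<forall>c. c \<in> atlas M \<and> p \<in> fst c \<longrightarrow> v c \<in> model M) \<and>
     (\<forall>c. \<not> (c \<in> atlas M \<and> p \<in> fst c) \<longrightarrow> v c = 0) \<and>
     (\<forall>c\<in>atlas M. \<forall>c'\<in>atlas M. p \<in> fst c \<and> p \<in> fst c' \<longrightarrow>
        v c' = transition_deriv M p c c' (v c))}"

text \<open>The tangent vector at \<open>p\<close> with coordinate vector \<open>w\<close> in the chart \<open>c\<close>.\<close>

definition tangent_of_coord ::
  "('m, 'a::euclidean_space) manifold \<Rightarrow> ('m, 'a) chart \<Rightarrow> 'm \<Rightarrow> 'a \<Rightarrow> ('m, 'a) tvec" where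
  "tangent_of_coord M c p w =
     (\<lambda>c'. if c' \<in> atlas M \<and> p \<in> fst c' then transition_deriv M p c c' w else 0)"

text \<open>
  A section of \<open>\<Lambda>T\<^sup>*M = \<Oplus>\<^sub>k \<Lambda>\<^sup>kT\<^sup>*M\<close>: at each point, the function on finite lists of tangent
  vectors whose restriction to the lists of length \<open>k\<close> is the alternating \<open>k\<close>-linear form that is
  the component of degree \<open>k\<close>.  (The components of degree above \<open>dim M\<close> vanish automatically.)
\<close>

type_synonym ('m, 'a) form = "'m \<Rightarrow> ('m, 'a) tvec list \<Rightarrow> real"

definition form_coord ::
  "('m, 'a::euclidean_space) manifold \<Rightarrow> ('m, 'a) chart \<Rightarrow> ('m, 'a) form \<Rightarrow> 'a list \<Rightarrow> 'a \<Rightarrow> real" where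
  "form_coord M c \<omega> ws x =
     \<omega> (chart_inv c x) (map (tangent_of_coord M c (chart_inv c x)) ws)"

definition forms_set :: "('m, 'a::euclidean_space) manifold \<Rightarrow> ('m, 'a) form set" where
  "forms_set M = {\<omega>.
     (\<forall>p vs. \<not> (p \<in> points M \<and> set vs \<subseteq> tangent_space M p) \<longrightarrow> \<omega> p vs = 0) \<and>
     (\<forall>p\<in>points M. \<forall>us ws u v r.
        set us \<union> set ws \<union> {u, v} \<subseteq> tangent_space M p \<longrightarrow>
        \<omega> p (us @ (\<lambda>c. u c + r *\<^sub>R v c) # ws) = \<omega> p (us @ u # ws) + r * \<omega> p (us @ v # ws)) \<and>
     (\<forall>p vs. \<not> distinct vs \<longrightarrow> \<omega> p vs = 0) \<and>
     (\<forall>c\<in>atlas M. \<forall>ws. set ws \<subseteq> model M \<longrightarrow>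
        smooth_on (model M) (snd c ` fst c) (form_coord M c \<omega> ws))}"

text \<open>
  The wedge product, as a sum over shuffles: \<open>I\<close> and its complement are the positions of the
  arguments of \<open>\<alpha>\<close> and of \<open>\<beta>\<close>, and the exponent counts the inversions of the shuffle.
\<close>

definition wedge :: "('m, 'a) form \<Rightarrow> ('m, 'a) form \<Rightarrow> ('m, 'a) form" where
  "wedge \<alpha> \<beta> = (\<lambda>p vs. \<Sum>I\<in>Pow {..<length vs}.
     (-1) ^ card {(i, j). i \<in> I \<and> j \<notin> I \<and> j < i} * \<alpha> p (nths vs I) * \<beta> p (nths vs (- I)))"

definition real_form :: "('m, 'a::euclidean_space) manifold \<Rightarrow> real \<Rightarrow> ('m, 'a) form" where
  "real_form M r = (\<lambda>p vs. if p \<in> points M \<and> vs = [] then r else 0)"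

definition form_scale :: "real \<Rightarrow> ('m, 'a) form \<Rightarrow> ('m, 'a) form" where
  "form_scale r \<omega> = (\<lambda>p vs. r * \<omega> p vs)"

text \<open>\<open>\<Omega>(M)\<close> as an algebra over \<open>C\<^sup>\<infinity>(M)\<close>.\<close>

definition Forms :: "('m, 'a::euclidean_space) manifold \<Rightarrow> ('m \<Rightarrow> real, ('m, 'a) form) module" where
  "Forms M = \<lparr>carrier = forms_set M,
     monoid.mult = wedge,
     one = real_form M 1,
     ring.zero = (\<lambda>p vs. 0),
     add = (\<lambda>\<alpha> \<beta> p vs. \<alpha> p vs + \<beta> p vs),
     smult = (\<lambda>f \<alpha> p vs. f p * \<alpha> p vs)\<rparr>"

definition Forms_part :: "('m, 'a::euclidean_space) manifold \<Rightarrow> bit \<Rightarrow> ('m, 'a) form set" where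
  "Forms_part M i = {\<omega> \<in> carrier (Forms M). \<forall>p vs. of_nat (length vs) \<noteq> i \<longrightarrow> \<omega> p vs = 0}"

text \<open>
  The exterior differential.  In a chart around \<open>p\<close>, and for coordinate vectors
  \<open>w\<^sub>0, \<dots>, w\<^sub>k\<close>, it is \<open>d\<omega>(w\<^sub>0, \<dots>, w\<^sub>k) = \<Sum>\<^sub>i (-1)\<^sup>i \<partial>\<^bsub>w\<^sub>i\<^esub>(\<omega>(w\<^sub>0, \<dots>, w\<^sub>i omitted, \<dots>, w\<^sub>k))\<close>.  The value
  does not depend on the chart, so an arbitrary one is chosen.
\<close>

definition chart_at :: "('m, 'a::euclidean_space) manifold \<Rightarrow> 'm \<Rightarrow> ('m, 'a) chart" where
  "chart_at M p = (SOME c. c \<in> atlas M \<and> p \<in> fst c)"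

definition ext_deriv_coord ::
  "('m, 'a::euclidean_space) manifold \<Rightarrow> ('m, 'a) chart \<Rightarrow> ('m, 'a) form \<Rightarrow> 'a list \<Rightarrow> 'a \<Rightarrow> real" where
  "ext_deriv_coord M c \<omega> ws x =
     (\<Sum>i<length ws. (-1) ^ i *
        frechet_derivative (form_coord M c \<omega> (take i ws @ drop (Suc i) ws))
          (at x within model M) (ws ! i))"

definition ext_deriv ::
  "('m, 'a::euclidean_space) manifold \<Rightarrow> ('m, 'a) form \<Rightarrow> ('m, 'a) form" where
  "ext_deriv M = (\<lambda>\<omega>\<in>carrier (Forms M). \<lambda>p vs.
     if p \<in> points M \<and> set vs \<subseteq> tangent_space M p
     then let c = chart_at M p in ext_deriv_coord M c \<omega> (map (\<lambda>v. v c) vs) (snd c p)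
     else 0)"

section \<open>Graded derivations of the algebra of forms\<close>

definition sign :: "bit \<Rightarrow> real" where
  "sign i = (if i = 1 then -1 else 1)"

definition Der_part ::
  "('m, 'a::euclidean_space) manifold \<Rightarrow> bit \<Rightarrow> (('m, 'a) form \<Rightarrow> ('m, 'a) form) set" where
  "Der_part M i = {\<delta> \<in> carrier (Forms M) \<rightarrow>\<^sub>E carrier (Forms M).
     (\<forall>\<alpha>\<in>carrier (Forms M). \<forall>\<beta>\<in>carrier (Forms M).
        \<delta> (\<alpha> \<oplus>\<^bsub>Forms M\<^esub> \<beta>) = \<delta> \<alpha> \<oplus>\<^bsub>Forms M\<^esub> \<delta> \<beta>) \<and>
     (\<forall>r. \<forall>\<alpha>\<in>carrier (Forms M). \<delta> (form_scale r \<alpha>) = form_scale r (\<delta> \<alpha>)) \<and>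
     (\<forall>j. \<forall>\<alpha>\<in>Forms_part M j. \<delta> \<alpha> \<in> Forms_part M (i + j)) \<and>
     (\<forall>j. \<forall>\<alpha>\<in>Forms_part M j. \<forall>\<beta>\<in>carrier (Forms M).
        \<delta> (\<alpha> \<otimes>\<^bsub>Forms M\<^esub> \<beta>) =
          \<delta> \<alpha> \<otimes>\<^bsub>Forms M\<^esub> \<beta> \<oplus>\<^bsub>Forms M\<^esub> form_scale (sign (j * i)) (\<alpha> \<otimes>\<^bsub>Forms M\<^esub> \<delta> \<beta>))}"

text \<open>
  The left \<open>\<Omega>(M)\<close>-module spanned by the homogeneous derivations; as \<open>Der_part M 0\<close> and
  \<open>Der_part M 1\<close> are closed under sums, and a form times a homogeneous derivation is a sum of an
  even and an odd derivation, a single summand of each parity suffices.  The ring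
  multiplication and unit inherited from the record of modules are meaningless here and in the
  modules below.
\<close>

definition Der ::
  "('m, 'a::euclidean_space) manifold \<Rightarrow> (('m, 'a) form, ('m, 'a) form \<Rightarrow> ('m, 'a) form) module" where
  "Der M = \<lparr>carrier = {\<lambda>\<omega>\<in>carrier (Forms M). \<delta>\<^sub>0 \<omega> \<oplus>\<^bsub>Forms M\<^esub> \<delta>\<^sub>1 \<omega> | \<delta>\<^sub>0 \<delta>\<^sub>1.
       \<delta>\<^sub>0 \<in> Der_part M 0 \<and> \<delta>\<^sub>1 \<in> Der_part M 1},
     monoid.mult = undefined,
     one = undefined,
     ring.zero = (\<lambda>\<omega>\<in>carrier (Forms M). \<zero>\<^bsub>Forms M\<^esub>),
     add = (\<lambda>\<delta> \<epsilon>. \<lambda>\<omega>\<in>carrier (Forms M). \<delta> \<omega> \<oplus>\<^bsub>Forms M\<^esub> \<epsilon> \<omega>),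
     smult = (\<lambda>\<beta> \<delta>. \<lambda>\<omega>\<in>carrier (Forms M). \<beta> \<otimes>\<^bsub>Forms M\<^esub> \<delta> \<omega>)\<rparr>"

section \<open>Supervector bundles\<close>

definition real_ring :: "real ring" where
  "real_ring = \<lparr>carrier = UNIV, monoid.mult = (*), one = 1, ring.zero = 0, add = (+)\<rparr>"

text \<open>
  A bundle is given by its fibres \<open>E\<^sub>p\<close> (so that the total space is their disjoint union), the
  homogeneous parts of the fibres, the homogeneous parts \<open>F\<^sub>0, F\<^sub>1\<close> of the typical fibre
  \<open>F\<^sub>0 \<oplus> F\<^sub>1\<close>, and an atlas of local trivialisations \<open>(U, \<Phi>)\<close>, where \<open>\<Phi> p\<close> maps \<open>E\<^sub>p\<close> to
  \<open>F\<^sub>0 \<oplus> F\<^sub>1\<close> for \<open>p \<in> U\<close>.  The parts of the typical fibre may be zero.  The topology and the smooth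
  structure of the total space are those determined by the trivialisations.
\<close>

record ('m, 'e, 'f) svbundle =
  fibre :: "'m \<Rightarrow> (real, 'e) module"
  fibre_part :: "bit \<Rightarrow> 'm \<Rightarrow> 'e set"
  typical_part :: "bit \<Rightarrow> 'f set"
  trivs :: "('m set \<times> ('m \<Rightarrow> 'e \<Rightarrow> 'f)) set"

definition typical_fibre :: "('m, 'e, 'f::euclidean_space) svbundle \<Rightarrow> 'f set" where
  "typical_fibre E = {x + y | x y. x \<in> typical_part E 0 \<and> y \<in> typical_part E 1}"

definition supervector_bundle ::
  "('m, 'a::euclidean_space) manifold \<Rightarrow> ('m, 'e, 'f::euclidean_space) svbundle \<Rightarrow> bool" where
  "supervector_bundle M E \<longleftrightarrow>
     (\<forall>i. subspace (typical_part E i)) \<and> typical_part E 0 \<inter> typical_part E 1 = {0} \<and>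
     (\<forall>p\<in>points M. module real_ring (fibre E p) \<and>
        (\<forall>i. fibre_part E i p \<subseteq> carrier (fibre E p))) \<and>
     (\<Union>t\<in>trivs E. fst t) = points M \<and>
     (\<forall>(U, \<Phi>)\<in>trivs E. openin (mtop M) U \<and>
        (\<forall>p\<in>U. bij_betw (\<Phi> p) (carrier (fibre E p)) (typical_fibre E) \<and>
          (\<forall>u\<in>carrier (fibre E p). \<forall>v\<in>carrier (fibre E p).
             \<Phi> p (u \<oplus>\<^bsub>fibre E p\<^esub> v) = \<Phi> p u + \<Phi> p v) \<and>
          (\<forall>r. \<forall>u\<in>carrier (fibre E p). \<Phi> p (r \<odot>\<^bsub>fibre E p\<^esub> u) = r *\<^sub>R \<Phi> p u) \<and>
          (\<forall>i. \<Phi> p ` fibre_part E i p = typical_part E i))) \<and>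
     (\<forall>(U, \<Phi>)\<in>trivs E. \<forall>(U', \<Phi>')\<in>trivs E. \<forall>x\<in>typical_fibre E.
        manifold_smooth_on M (U \<inter> U')
          (\<lambda>p. \<Phi>' p (inv_into (carrier (fibre E p)) (\<Phi> p) x)))"

text \<open>The \<open>C\<^sup>\<infinity>(M)\<close>-module \<open>\<Gamma>(E)\<close> of smooth sections.\<close>

definition Sections ::
  "('m, 'a::euclidean_space) manifold \<Rightarrow> ('m, 'e, 'f::euclidean_space) svbundle \<Rightarrow>
   ('m \<Rightarrow> real, 'm \<Rightarrow> 'e) module" where
  "Sections M E = \<lparr>carrier = {s \<in> (\<Pi>\<^sub>E p\<in>points M. carrier (fibre E p)).
       \<forall>(U, \<Phi>)\<in>trivs E. manifold_smooth_on M U (\<lambda>p. \<Phi> p (s p))},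
     monoid.mult = undefined,
     one = undefined,
     ring.zero = (\<lambda>p\<in>points M. \<zero>\<^bsub>fibre E p\<^esub>),
     add = (\<lambda>s t. \<lambda>p\<in>points M. s p \<oplus>\<^bsub>fibre E p\<^esub> t p),
     smult = (\<lambda>f s. \<lambda>p\<in>points M. f p \<odot>\<^bsub>fibre E p\<^esub> s p)\<rparr>"

definition Sections_part ::
  "('m, 'a::euclidean_space) manifold \<Rightarrow> ('m, 'e, 'f::euclidean_space) svbundle \<Rightarrow> bit \<Rightarrow>
   ('m \<Rightarrow> 'e) set" where
  "Sections_part M E i = {s \<in> carrier (Sections M E). \<forall>p\<in>points M. s p \<in> fibre_part E i p}"

section \<open>Tensor products and bundle-valued forms\<close>

text \<open>
  The tensor product over a commutative ring \<open>R\<close> of an \<open>R\<close>-algebra \<open>A\<close> and an \<open>R\<close>-module \<open>B\<close>: the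
  quotient of the free abelian group on \<open>A \<times> B\<close> by the bilinearity relations, as a left
  \<open>A\<close>-module.
\<close>

definition tensor_relations ::
  "'r ring \<Rightarrow> ('r, 'a) module \<Rightarrow> ('r, 'b) module \<Rightarrow> (('a \<times> 'b) \<Rightarrow>\<^sub>0 int) set" where
  "tensor_relations R A B =
     {frag_of (a \<oplus>\<^bsub>A\<^esub> a', b) - frag_of (a, b) - frag_of (a', b) | a a' b.
        a \<in> carrier A \<and> a' \<in> carrier A \<and> b \<in> carrier B} \<union>
     {frag_of (a, b \<oplus>\<^bsub>B\<^esub> b') - frag_of (a, b) - frag_of (a, b') | a b b'.
        a \<in> carrier A \<and> b \<in> carrier B \<and> b' \<in> carrier B} \<union>
     {frag_of (r \<odot>\<^bsub>A\<^esub> a, b) - frag_of (a, r \<odot>\<^bsub>B\<^esub> b) | r a b.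
        r \<in> carrier R \<and> a \<in> carrier A \<and> b \<in> carrier B}"

definition tensor_kernel ::
  "'r ring \<Rightarrow> ('r, 'a) module \<Rightarrow> ('r, 'b) module \<Rightarrow> (('a \<times> 'b) \<Rightarrow>\<^sub>0 int) set" where
  "tensor_kernel R A B =
     generate (free_Abelian_group (carrier A \<times> carrier B)) (tensor_relations R A B)"

definition tensor_class ::
  "'r ring \<Rightarrow> ('r, 'a) module \<Rightarrow> ('r, 'b) module \<Rightarrow> (('a \<times> 'b) \<Rightarrow>\<^sub>0 int) \<Rightarrow> (('a \<times> 'b) \<Rightarrow>\<^sub>0 int) set"
  where
  "tensor_class R A B x =
     tensor_kernel R A B #>\<^bsub>free_Abelian_group (carrier A \<times> carrier B)\<^esub> x"

text \<open>
  The union in the scalar multiplication is over equal sets: left multiplication by an element of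
  \<open>A\<close> respects the bilinearity relations.
\<close>

definition tensor_module ::
  "'r ring \<Rightarrow> ('r, 'a) module \<Rightarrow> ('r, 'b) module \<Rightarrow> ('a, (('a \<times> 'b) \<Rightarrow>\<^sub>0 int) set) module" where
  "tensor_module R A B =
     (let Q = free_Abelian_group (carrier A \<times> carrier B) Mod tensor_kernel R A B
      in \<lparr>carrier = carrier Q,
          monoid.mult = undefined,
          one = undefined,
          ring.zero = \<one>\<^bsub>Q\<^esub>,
          add = monoid.mult Q,
          smult = (\<lambda>a X. \<Union>x\<in>X. tensor_class R A B
            (frag_extend (\<lambda>(a', b). frag_of (a \<otimes>\<^bsub>A\<^esub> a', b)) x))\<rparr>)"

text \<open>\<open>\<Omega>(M; E) = \<L> = \<Omega>(M) \<otimes> \<Gamma>(E)\<close>, its decomposable elements and its homogeneous parts.\<close>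

definition EForms ::
  "('m, 'a::euclidean_space) manifold \<Rightarrow> ('m, 'e, 'f::euclidean_space) svbundle \<Rightarrow>
   (('m, 'a) form, ((('m, 'a) form \<times> ('m \<Rightarrow> 'e)) \<Rightarrow>\<^sub>0 int) set) module" where
  "EForms M E = tensor_module (Cinf M) (Forms M) (Sections M E)"

definition tensor ::
  "('m, 'a::euclidean_space) manifold \<Rightarrow> ('m, 'e, 'f::euclidean_space) svbundle \<Rightarrow>
   ('m, 'a) form \<Rightarrow> ('m \<Rightarrow> 'e) \<Rightarrow> ((('m, 'a) form \<times> ('m \<Rightarrow> 'e)) \<Rightarrow>\<^sub>0 int) set" where
  "tensor M E \<alpha> \<phi> = tensor_class (Cinf M) (Forms M) (Sections M E) (frag_of (\<alpha>, \<phi>))"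

definition EForms_part ::
  "('m, 'a::euclidean_space) manifold \<Rightarrow> ('m, 'e, 'f::euclidean_space) svbundle \<Rightarrow> bit \<Rightarrow>
   ((('m, 'a) form \<times> ('m \<Rightarrow> 'e)) \<Rightarrow>\<^sub>0 int) set set" where
  "EForms_part M E i = generate (add_monoid (EForms M E))
     {tensor M E \<alpha> \<phi> | \<alpha> \<phi> j k. \<alpha> \<in> Forms_part M j \<and> \<phi> \<in> Sections_part M E k \<and> j + k = i}"

section \<open>Graded connections and superconnections\<close>

text \<open>
  The real scalars act on an \<open>\<Omega>(M)\<close>-module through the constant functions.  The type \<open>'l\<close> is that
  of the elements of the module.
\<close>

definition real_scale ::
  "('m, 'a::euclidean_space) manifold \<Rightarrow> (('m, 'a) form, 'l) module \<Rightarrow> real \<Rightarrow> 'l \<Rightarrow> 'l" where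
  "real_scale M L r x = real_form M r \<odot>\<^bsub>L\<^esub> x"

definition End_real ::
  "('m, 'a::euclidean_space) manifold \<Rightarrow> (('m, 'a) form, 'l) module \<Rightarrow>
   (('m, 'a) form, 'l \<Rightarrow> 'l) module" where
  "End_real M L = \<lparr>carrier = {T \<in> carrier L \<rightarrow>\<^sub>E carrier L.
       (\<forall>x\<in>carrier L. \<forall>y\<in>carrier L. T (x \<oplus>\<^bsub>L\<^esub> y) = T x \<oplus>\<^bsub>L\<^esub> T y) \<and>
       (\<forall>r. \<forall>x\<in>carrier L. T (real_scale M L r x) = real_scale M L r (T x))},
     monoid.mult = undefined,
     one = undefined,
     ring.zero = (\<lambda>x\<in>carrier L. \<zero>\<^bsub>L\<^esub>),
     add = (\<lambda>S T. \<lambda>x\<in>carrier L. S x \<oplus>\<^bsub>L\<^esub> T x),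
     smult = (\<lambda>\<beta> T. \<lambda>x\<in>carrier L. \<beta> \<odot>\<^bsub>L\<^esub> T x)\<rparr>"

definition graded_connection ::
  "('m, 'a::euclidean_space) manifold \<Rightarrow> ('m, 'e, 'f::euclidean_space) svbundle \<Rightarrow>
   ((('m, 'a) form \<Rightarrow> ('m, 'a) form) \<Rightarrow>
     ((('m, 'a) form \<times> ('m \<Rightarrow> 'e)) \<Rightarrow>\<^sub>0 int) set \<Rightarrow> ((('m, 'a) form \<times> ('m \<Rightarrow> 'e)) \<Rightarrow>\<^sub>0 int) set) \<Rightarrow> bool"
  where
  "graded_connection M E nab \<longleftrightarrow>
     (let L = EForms M E in
        nab \<in> carrier (Der M) \<rightarrow> carrier (End_real M L) \<and>
        (\<forall>\<delta>\<in>carrier (Der M). \<forall>\<epsilon>\<in>carrier (Der M).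
           nab (\<delta> \<oplus>\<^bsub>Der M\<^esub> \<epsilon>) = nab \<delta> \<oplus>\<^bsub>End_real M L\<^esub> nab \<epsilon>) \<and>
        (\<forall>\<beta>\<in>carrier (Forms M). \<forall>\<delta>\<in>carrier (Der M).
           nab (\<beta> \<odot>\<^bsub>Der M\<^esub> \<delta>) = \<beta> \<odot>\<^bsub>End_real M L\<^esub> nab \<delta>) \<and>
        (\<forall>i j. \<forall>\<delta>\<in>Der_part M i. \<forall>x\<in>EForms_part M E j. nab \<delta> x \<in> EForms_part M E (i + j)) \<and>
        (\<forall>i j. \<forall>\<delta>\<in>Der_part M i. \<forall>\<alpha>\<in>Forms_part M j. \<forall>x\<in>carrier L.
           nab \<delta> (\<alpha> \<odot>\<^bsub>L\<^esub> x) =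
             \<delta> \<alpha> \<odot>\<^bsub>L\<^esub> x \<oplus>\<^bsub>L\<^esub> real_scale M L (sign (j * i)) (\<alpha> \<odot>\<^bsub>L\<^esub> nab \<delta> x)))"

definition quillen_superconnection ::
  "('m, 'a::euclidean_space) manifold \<Rightarrow> ('m, 'e, 'f::euclidean_space) svbundle \<Rightarrow>
   (((('m, 'a) form \<times> ('m \<Rightarrow> 'e)) \<Rightarrow>\<^sub>0 int) set \<Rightarrow> ((('m, 'a) form \<times> ('m \<Rightarrow> 'e)) \<Rightarrow>\<^sub>0 int) set) \<Rightarrow> bool"
  where
  "quillen_superconnection M E D \<longleftrightarrow>
     (let L = EForms M E in
        D \<in> carrier (End_real M L) \<and>
        (\<forall>j. \<forall>x\<in>EForms_part M E j. D x \<in> EForms_part M E (j + 1)) \<and>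
        (\<forall>j. \<forall>\<alpha>\<in>Forms_part M j. \<forall>x\<in>carrier L.
           D (\<alpha> \<odot>\<^bsub>L\<^esub> x) =
             ext_deriv M \<alpha> \<odot>\<^bsub>L\<^esub> x \<oplus>\<^bsub>L\<^esub> real_scale M L (sign j) (\<alpha> \<odot>\<^bsub>L\<^esub> D x)))"

text \<open>
  A formula for decomposable elements defines an operator on \<open>\<Omega>(M; E)\<close> by additive extension;
  \<open>induced_operator M E nab D\<close> says that \<open>D\<close> arises in this way from
  \<open>\<alpha> \<otimes> \<phi> \<mapsto> nab\<^bsub>d\<^esub> (\<alpha>\<phi>)\<close>.
\<close>

definition induced_operator ::
  "('m, 'a::euclidean_space) manifold \<Rightarrow> ('m, 'e, 'f::euclidean_space) svbundle \<Rightarrow>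
   ((('m, 'a) form \<Rightarrow> ('m, 'a) form) \<Rightarrow>
     ((('m, 'a) form \<times> ('m \<Rightarrow> 'e)) \<Rightarrow>\<^sub>0 int) set \<Rightarrow> ((('m, 'a) form \<times> ('m \<Rightarrow> 'e)) \<Rightarrow>\<^sub>0 int) set) \<Rightarrow>
   (((('m, 'a) form \<times> ('m \<Rightarrow> 'e)) \<Rightarrow>\<^sub>0 int) set \<Rightarrow> ((('m, 'a) form \<times> ('m \<Rightarrow> 'e)) \<Rightarrow>\<^sub>0 int) set) \<Rightarrow> bool"
  where
  "induced_operator M E nab D \<longleftrightarrow>
     (let L = EForms M E in
        D \<in> extensional (carrier L) \<and> D \<in> hom (add_monoid L) (add_monoid L) \<and>
        (\<forall>\<alpha>\<in>carrier (Forms M). \<forall>\<phi>\<in>carrier (Sections M E).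
           D (tensor M E \<alpha> \<phi>) = nab (ext_deriv M) (tensor M E \<alpha> \<phi>)))"

end

theory Submission
  imports Defs
begin

text \<open>
  The operator is \<open>\<nabla>\<close> at the exterior differential; the superconnection rule is the connection rule for
  \<open>\<delta> = d\<close>, and uniqueness holds because the decomposable elements generate the tensor product.  What
  has to be shown is that \<open>d\<close>, given by a formula in an arbitrarily chosen chart, is an odd derivation of
  \<open>\<Omega>(M)\<close>.  Both the shuffle product and the alternating sum defining \<open>d\<close> satisfy a recursion that
  splits off the first argument, so alternation, the Leibniz rule and the cancellation of second
  derivatives follow by induction on the list of arguments.
\<close>

section \<open>Multilinear and alternating functions on lists\<close>

text \<open>\<open>ext_deriv\<close> evaluates the coordinate formula at p in the chart
  \<open>chart_at M p\<close>, an arbitrary choice at each point. Until the value is known to be the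
  same in every chart, not even smoothness of d\<omega> is visible, and no derivative formula can be
  applied around p in a fixed chart. The obstacle is therefore chart independence. Seen from another
  chart, a coefficient of \<omega> has arguments that are images under the derivative of the
  coordinate change and so move with the base point; differentiating it produces terms with second
  derivatives of that change. Two tools answer this: a product rule for a multilinear function whose
  values and arguments both vary (\<open>has_derivative_multilinear\<close>), and symmetry of second
  derivatives. Both are proved relative to a linear subspace V, where a derivative is determined
  only on vectors of V, which is why membership in V is tracked throughout.\<close>

text \<open>The operation u + r v is the parameter \<open>comb\<close>, because the same facts serve
  tangent vectors, which are families indexed by charts, and coordinate vectors.\<close>

definition multilinear_on :: "('v \<Rightarrow> real \<Rightarrow> 'v \<Rightarrow> 'v) \<Rightarrow> 'v set \<Rightarrow> ('v list \<Rightarrow> real) \<Rightarrow> bool" where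
  "multilinear_on comb T F \<longleftrightarrow> (\<forall>us ws u v r. set us \<union> set ws \<union> {u, v} \<subseteq> T \<longrightarrow>
     F (us @ comb u r v # ws) = F (us @ u # ws) + r * F (us @ v # ws))"

text \<open>Only equal neighbours are tested: this is the form that inductions splitting off the
  first argument can carry. Arbitrary repetitions are recovered in
  \<open>alternating_on_not_distinct\<close>.\<close>

definition alternating_on :: "'v set \<Rightarrow> ('v list \<Rightarrow> real) \<Rightarrow> bool" where
  "alternating_on T F \<longleftrightarrow> (\<forall>us ws u. set us \<union> set ws \<union> {u} \<subseteq> T \<longrightarrow> F (us @ u # u # ws) = 0)"

lemma multilinear_onD:
  "multilinear_on comb T F \<Longrightarrow> set us \<subseteq> T \<Longrightarrow> set ws \<subseteq> T \<Longrightarrow> u \<in> T \<Longrightarrow> v \<in> T \<Longrightarrow>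
    F (us @ comb u r v # ws) = F (us @ u # ws) + r * F (us @ v # ws)"
  unfolding multilinear_on_def by simp

lemma alternating_onD:
  "alternating_on T F \<Longrightarrow> set us \<subseteq> T \<Longrightarrow> set ws \<subseteq> T \<Longrightarrow> u \<in> T \<Longrightarrow> F (us @ u # u # ws) = 0"
  unfolding alternating_on_def by simp

lemma multilinear_on_Cons:
  "multilinear_on comb T F \<Longrightarrow> a \<in> T \<Longrightarrow> multilinear_on comb T (\<lambda>us. F (a # us))"
  unfolding multilinear_on_def by (metis append_Cons insert_subset list.simps(15) le_sup_iff)

lemma alternating_on_Cons:
  "alternating_on T F \<Longrightarrow> a \<in> T \<Longrightarrow> alternating_on T (\<lambda>us. F (a # us))"
  unfolding alternating_on_def by (metis append_Cons insert_subset list.simps(15) le_sup_iff)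

text \<open>Polarisation: F vanishes with u + v in both slots, and expanding both slots leaves only
  the two mixed terms.\<close>

lemma alternating_on_swap:
  assumes T: "\<And>u v r. u \<in> T \<Longrightarrow> v \<in> T \<Longrightarrow> comb u r v \<in> T"
    and ml: "multilinear_on comb T F" and alt: "alternating_on T F"
    and s: "set us \<subseteq> T" "set ws \<subseteq> T" "u \<in> T" "v \<in> T"
  shows "F (us @ u # v # ws) = - F (us @ v # u # ws)"
proof -
  let ?w = "comb u 1 v"
  have w: "?w \<in> T" using T s by blast
  have a: "F (us @ x # x # ws) = 0" if "x \<in> T" for x
    using alt that s by (simp add: alternating_on_def)
  have "0 = F (us @ ?w # ?w # ws)" using a w by simp
  also have "\<dots> = F (us @ u # ?w # ws) + 1 * F (us @ v # ?w # ws)"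
    using multilinear_onD[OF ml, of us "?w # ws" u v 1] s w by simp
  also have "F (us @ u # ?w # ws) = F (us @ u # u # ws) + 1 * F (us @ u # v # ws)"
    using multilinear_onD[OF ml, of "us @ [u]" ws u v 1] s by simp
  also have "F (us @ v # ?w # ws) = F (us @ v # u # ws) + 1 * F (us @ v # v # ws)"
    using multilinear_onD[OF ml, of "us @ [v]" ws u v 1] s by simp
  finally show ?thesis using a s by simp
qed

text \<open>Transpositions of neighbours, which only change the sign, move the first of two equal
  entries to the right until it meets the second.\<close>

lemma alternating_on_not_distinct:
  assumes T: "\<And>u v r. u \<in> T \<Longrightarrow> v \<in> T \<Longrightarrow> comb u r v \<in> T"
    and ml: "multilinear_on comb T F" and alt: "alternating_on T F"
    and s: "set vs \<subseteq> T" "\<not> distinct vs"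
  shows "F vs = 0"
proof -
  have gap: "F (us @ u # xs @ u # ws) = 0"
    if "set us \<subseteq> T" "set xs \<subseteq> T" "set ws \<subseteq> T" "u \<in> T" for us u xs ws
    using that
  proof (induction xs arbitrary: us)
    case Nil
    then show ?case using alt by (simp add: alternating_on_def)
  next
    case (Cons x xs)
    have "F (us @ u # x # (xs @ u # ws)) = - F ((us @ [x]) @ u # xs @ u # ws)"
      using alternating_on_swap[OF T ml alt, of us "xs @ u # ws" u x] Cons.prems by simp
    then show ?case using Cons.IH[of "us @ [x]"] Cons.prems by simp
  qed
  obtain xs ys zs y where "vs = xs @ [y] @ ys @ [y] @ zs"
    using not_distinct_decomp[OF s(2)] by blast
  then show ?thesis using gap[of xs ys zs y] s by auto
qed

lemma multilinear_on_map:
  assumes "multilinear_on comb V F" "g ` T \<subseteq> V"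
    and "\<And>u v r. u \<in> T \<Longrightarrow> v \<in> T \<Longrightarrow> g (comb' u r v) = comb (g u) r (g v)"
  shows "multilinear_on comb' T (\<lambda>vs. F (map g vs))"
  unfolding multilinear_on_def
proof (intro allI impI)
  fix us ws u v r assume s: "set us \<union> set ws \<union> {u, v} \<subseteq> T"
  then have "set (map g us) \<subseteq> V" "set (map g ws) \<subseteq> V" "g u \<in> V" "g v \<in> V"
    using assms(2) by auto
  from multilinear_onD[OF assms(1) this, of r]
  show "F (map g (us @ comb' u r v # ws)) = F (map g (us @ u # ws)) + r * F (map g (us @ v # ws))"
    using assms(3) s by simp
qed

lemma alternating_on_map:
  assumes "alternating_on V F" "g ` T \<subseteq> V"
  shows "alternating_on T (\<lambda>vs. F (map g vs))"
  unfolding alternating_on_def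
proof (intro allI impI)
  fix us ws u assume "set us \<union> set ws \<union> {u} \<subseteq> T"
  then have "set (map g us) \<subseteq> V" "set (map g ws) \<subseteq> V" "g u \<in> V"
    using assms(2) by auto
  from alternating_onD[OF assms(1) this] show "F (map g (us @ u # u # ws)) = 0" by simp
qed

lemma multilinear_on_cong:
  assumes "\<And>u v r. u \<in> T \<Longrightarrow> v \<in> T \<Longrightarrow> comb u r v \<in> T"
    and "\<And>vs. set vs \<subseteq> T \<Longrightarrow> F vs = G vs" "multilinear_on comb T F"
  shows "multilinear_on comb T G"
  unfolding multilinear_on_def
proof (intro allI impI)
  fix us ws u v r assume "set us \<union> set ws \<union> {u, v} \<subseteq> T"
  then have s: "set us \<subseteq> T" "set ws \<subseteq> T" "u \<in> T" "v \<in> T" by auto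
  then show "G (us @ comb u r v # ws) = G (us @ u # ws) + r * G (us @ v # ws)"
    using multilinear_onD[OF assms(3) s, of r] assms(1)[of u v r] by (simp add: assms(2)[symmetric])
qed

lemma alternating_on_cong:
  assumes "\<And>vs. set vs \<subseteq> T \<Longrightarrow> F vs = G vs" "alternating_on T F"
  shows "alternating_on T G"
  using assms unfolding alternating_on_def by (metis Un_subset_iff insert_subset list.simps(15) set_append)

section \<open>Alternating sums over one omitted argument\<close>

text \<open>If \<open>\<phi> u us\<close> is the derivative in direction u of the coefficient of a
  form at \<open>us\<close>, this is the coordinate formula for d. Keeping \<phi> abstract separates
  the algebra of signs from analysis.\<close>

definition altsum :: "('v \<Rightarrow> 'v list \<Rightarrow> real) \<Rightarrow> 'v list \<Rightarrow> real" where
  "altsum \<phi> ws = (\<Sum>i<length ws. (-1) ^ i * \<phi> (ws ! i) (take i ws @ drop (Suc i) ws))"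

lemma altsum_Nil [simp]: "altsum \<phi> [] = 0"
  by (simp add: altsum_def)

text \<open>Omitting a later entry keeps v at the head and counts its position one higher than in
  ws, whence the minus sign.\<close>

lemma altsum_Cons [simp]: "altsum \<phi> (v # ws) = \<phi> v ws - altsum (\<lambda>u us. \<phi> u (v # us)) ws"
  by (simp add: altsum_def lessThan_Suc_eq_insert_0 sum.insert_if sum.reindex sum_negf
      flip: lessThan_Suc_atMost del: sum.lessThan_Suc)

lemma altsum_add: "altsum (\<lambda>u us. \<phi> u us + \<psi> u us) ws = altsum \<phi> ws + altsum \<psi> ws"
  by (simp add: altsum_def sum.distrib algebra_simps)

lemma altsum_cmult: "altsum (\<lambda>u us. r * \<phi> u us) ws = r * altsum \<phi> ws"
  by (simp add: altsum_def sum_distrib_left algebra_simps)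

lemma altsum_cong:
  assumes "set ws \<subseteq> T" "\<And>u us. u \<in> T \<Longrightarrow> set us \<subseteq> T \<Longrightarrow> \<phi> u us = \<psi> u us"
  shows "altsum \<phi> ws = altsum \<psi> ws"
  using assms
proof (induction ws arbitrary: \<phi> \<psi>)
  case (Cons w ws)
  have "altsum (\<lambda>u us. \<phi> u (w # us)) ws = altsum (\<lambda>u us. \<psi> u (w # us)) ws"
    by (rule Cons.IH) (use Cons.prems in auto)
  then show ?case using Cons.prems by auto
qed simp

lemma altsum_map: "altsum \<phi> (map f ws) = altsum (\<lambda>u us. \<phi> (f u) (map f us)) ws"
  by (induction ws arbitrary: \<phi>) simp_all

text \<open>Each \<open>us\<close> occurring in the sum is one entry shorter than \<open>ws\<close>;
  this is the source of the minus sign.\<close>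

lemma altsum_parity: "altsum (\<lambda>u us. (-1) ^ length us * \<phi> u us) ws = - ((-1) ^ length ws * altsum \<phi> ws)"
proof (induction ws arbitrary: \<phi>)
  case (Cons w ws)
  have "altsum (\<lambda>u us. (-1) ^ length (w # us) * \<phi> u (w # us)) ws
      = altsum (\<lambda>u us. -1 * ((-1) ^ length us * \<phi> u (w # us))) ws" by simp
  also have "\<dots> = (-1) ^ length ws * altsum (\<lambda>u us. \<phi> u (w # us)) ws"
    unfolding altsum_cmult Cons.IH by simp
  finally show ?case by (simp add: algebra_simps)
qed simp

text \<open>The combined argument is either the entry split off, in which \<phi> is linear, or an
  entry of the remaining list, in which \<open>\<phi> u\<close> is multilinear.\<close>

lemma altsum_multilinear:
  assumes T: "\<And>u v r. u \<in> T \<Longrightarrow> v \<in> T \<Longrightarrow> comb u r v \<in> T"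
    and "\<And>u. u \<in> T \<Longrightarrow> multilinear_on comb T (\<phi> u)"
    and "\<And>u v r us. u \<in> T \<Longrightarrow> v \<in> T \<Longrightarrow> set us \<subseteq> T \<Longrightarrow> \<phi> (comb u r v) us = \<phi> u us + r * \<phi> v us"
  shows "multilinear_on comb T (altsum \<phi>)"
proof -
  have "altsum \<phi> (us @ comb u r v # ws) = altsum \<phi> (us @ u # ws) + r * altsum \<phi> (us @ v # ws)"
    if "set us \<subseteq> T" "set ws \<subseteq> T" "u \<in> T" "v \<in> T" for us ws u v r
    using assms(2,3) that
  proof (induction us arbitrary: \<phi>)
    case Nil
    have "altsum (\<lambda>a as. \<phi> a (comb u r v # as)) ws
        = altsum (\<lambda>a as. \<phi> a (u # as) + r * \<phi> a (v # as)) ws"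
      by (rule altsum_cong[of _ T])
        (use Nil multilinear_onD[of comb T "\<phi> _" "[]"] in auto)
    then show ?case using Nil by (simp add: altsum_add altsum_cmult algebra_simps)
  next
    case (Cons x us)
    have IH: "altsum (\<lambda>a as. \<phi> a (x # as)) (us @ comb u r v # ws) =
        altsum (\<lambda>a as. \<phi> a (x # as)) (us @ u # ws) + r * altsum (\<lambda>a as. \<phi> a (x # as)) (us @ v # ws)"
      by (rule Cons.IH) (use Cons.prems in \<open>auto intro: multilinear_on_Cons\<close>)
    have "multilinear_on comb T (\<phi> x)" using Cons.prems by simp
    from multilinear_onD[OF this, of us ws u v r] IH Cons.prems
    show ?case by (simp add: algebra_simps)
  qed
  then show ?thesis by (simp add: multilinear_on_def)
qed

text \<open>Omitting one or the other of two equal neighbours leaves the same list with opposite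
  signs; every other term still contains both copies and vanishes.\<close>

lemma altsum_alternating:
  assumes "\<And>u. u \<in> T \<Longrightarrow> alternating_on T (\<phi> u)"
  shows "alternating_on T (altsum \<phi>)"
proof -
  have "altsum \<phi> (us @ u # u # ws) = 0"
    if "set us \<subseteq> T" "set ws \<subseteq> T" "u \<in> T" for us ws u
    using assms that
  proof (induction us arbitrary: \<phi>)
    case Nil
    have "\<phi> a (u # u # as) = 0" if "a \<in> T" "set as \<subseteq> T" for a as
      using alternating_onD[OF Nil(1)[OF that(1)], of "[]" as u] that Nil by simp
    \<comment> \<open>The zero summand is written as a multiple of \<phi>, so that
      \<open>altsum_cmult\<close> evaluates the sum.\<close>
    then have "altsum (\<lambda>a as. \<phi> a (u # u # as)) ws = altsum (\<lambda>a as. 0 * \<phi> a as) ws"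
      using Nil.prems by (auto intro!: altsum_cong[of _ T])
    then show ?case by (simp only: append_Nil altsum_Cons altsum_cmult)
  next
    case (Cons x us)
    have "altsum (\<lambda>a as. \<phi> a (x # as)) (us @ u # u # ws) = 0"
      by (rule Cons.IH) (use Cons.prems in \<open>auto intro: alternating_on_Cons\<close>)
    moreover have "alternating_on T (\<phi> x)" using Cons.prems by simp
    ultimately show ?case using Cons.prems by (simp add: alternating_on_def)
  qed
  then show ?thesis by (simp add: alternating_on_def)
qed

section \<open>Sums over shuffles\<close>

definition inversions :: "nat set \<Rightarrow> (nat \<times> nat) set" where
  "inversions I = {(i, j). i \<in> I \<and> j \<notin> I \<and> j < i}"

text \<open>The wedge product with the base point removed, so that it applies both to forms at a
  point and to their coordinate expressions.\<close>

definition shuffle_prod :: "('v list \<Rightarrow> real) \<Rightarrow> ('v list \<Rightarrow> real) \<Rightarrow> 'v list \<Rightarrow> real" where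
  "shuffle_prod a b vs = (\<Sum>I\<in>Pow {..<length vs}.
     (-1) ^ card (inversions I) * a (nths vs I) * b (nths vs (- I)))"

lemma wedge_shuffle_prod: "wedge \<alpha> \<beta> p = shuffle_prod (\<alpha> p) (\<beta> p)"
  by (simp add: wedge_def shuffle_prod_def inversions_def fun_eq_iff)

lemma shuffle_prod_Nil [simp]: "shuffle_prod a b [] = a [] * b []"
  by (simp add: shuffle_prod_def inversions_def)

lemma finite_inversions: "finite I \<Longrightarrow> finite (inversions I)"
proof -
  assume "finite I"
  then have "finite (Sigma I (\<lambda>i. {..<i}))" by simp
  then show ?thesis by (rule rev_finite_subset) (auto simp: inversions_def)
qed

text \<open>No position lies below 0, so the new element of the set creates no inversion.\<close>

lemma card_inversions_insert_0: "card (inversions (insert 0 (Suc ` I))) = card (inversions I)"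
proof -
  have "inversions (insert 0 (Suc ` I)) = map_prod Suc Suc ` inversions I"
    by (force simp: inversions_def image_iff elim: less_natE)
  then show ?thesis by (simp add: card_image prod.inj_map inj_on_subset[OF prod.inj_map])
qed

text \<open>The new position 0 lies in the complement and below every element of the shifted set,
  which gives one more inversion for each element of I.\<close>

lemma card_inversions_Suc:
  assumes "finite I"
  shows "card (inversions (Suc ` I)) = card (inversions I) + card I"
proof -
  have "inversions (Suc ` I) = map_prod Suc Suc ` inversions I \<union> (\<lambda>i. (Suc i, 0)) ` I"
  proof (intro subset_antisym subsetI)
    fix x assume "x \<in> inversions (Suc ` I)"
    then obtain i j where "x = (Suc i, j)" "i \<in> I" "j \<notin> Suc ` I" "j < Suc i"
      by (auto simp: inversions_def)
    then show "x \<in> map_prod Suc Suc ` inversions I \<union> (\<lambda>i. (Suc i, 0)) ` I"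
      by (cases j) (auto simp: inversions_def image_iff)
  qed (auto simp: inversions_def)
  moreover have "card ((\<lambda>i. (Suc i, 0::nat)) ` I) = card I"
    by (intro card_image) (auto simp: inj_on_def)
  moreover have "map_prod Suc Suc ` inversions I \<inter> (\<lambda>i. (Suc i, 0)) ` I = {}" by auto
  moreover have "card (map_prod Suc Suc ` inversions I) = card (inversions I)"
    by (intro card_image inj_on_subset[OF prod.inj_map]) auto
  ultimately show ?thesis
    using assms by (simp add: card_Un_disjoint finite_inversions)
qed

lemma Pow_lessThan_Suc:
  "Pow {..<Suc n} = (\<lambda>I. insert 0 (Suc ` I)) ` Pow {..<n} \<union> (`) Suc ` Pow {..<n}"
proof (intro subset_antisym subsetI)
  fix I assume I: "I \<in> Pow {..<Suc n}"
  define J where "J = {i. Suc i \<in> I}"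
  have "J \<in> Pow {..<n}" using I by (auto simp: J_def)
  moreover have "I = insert 0 (Suc ` J) \<or> I = Suc ` J"
  proof (cases "0 \<in> I")
    case True
    have "x \<in> insert 0 (Suc ` J)" if "x \<in> I" for x using that by (cases x) (auto simp: J_def)
    then show ?thesis using True by (auto simp: J_def)
  next
    case False
    have "x \<in> Suc ` J" if "x \<in> I" for x using that False by (cases x) (auto simp: J_def)
    then show ?thesis by (auto simp: J_def)
  qed
  ultimately show "I \<in> (\<lambda>I. insert 0 (Suc ` I)) ` Pow {..<n} \<union> (`) Suc ` Pow {..<n}" by blast
qed auto

lemma nths_Cons_Suc_image:
  "nths (v # vs) (Suc ` I) = nths vs I"
  "nths (v # vs) (insert 0 (Suc ` I)) = v # nths vs I"
  "nths (v # vs) (- Suc ` I) = v # nths vs (- I)"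
  "nths (v # vs) (- insert 0 (Suc ` I)) = nths vs (- I)"
proof -
  have "{j. Suc j \<in> Suc ` I} = I" "{j. Suc j \<in> insert 0 (Suc ` I)} = I"
    "{j. Suc j \<in> - Suc ` I} = - I" "{j. Suc j \<in> - insert 0 (Suc ` I)} = - I"
    by auto
  then show "nths (v # vs) (Suc ` I) = nths vs I"
    "nths (v # vs) (insert 0 (Suc ` I)) = v # nths vs I"
    "nths (v # vs) (- Suc ` I) = v # nths vs (- I)"
    "nths (v # vs) (- insert 0 (Suc ` I)) = nths vs (- I)"
    unfolding nths_Cons by auto
qed

lemma length_nths_Pow: "I \<in> Pow {..<length vs} \<Longrightarrow> length (nths vs I) = card I"
proof -
  assume "I \<in> Pow {..<length vs}"
  then have "{i. i < length vs \<and> i \<in> I} = I" by auto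
  then show ?thesis by (simp add: length_nths)
qed

text \<open>The first argument goes to a or to b. On its way to b it passes all arguments given to
  a, and this sign is stored as the twist \<open>(-1) ^ length us\<close> of a.\<close>

lemma shuffle_prod_Cons:
  "shuffle_prod a b (v # vs) =
     shuffle_prod (\<lambda>us. a (v # us)) b vs
     + shuffle_prod (\<lambda>us. (-1) ^ length us * a us) (\<lambda>us. b (v # us)) vs"
proof -
  let ?t = "\<lambda>I. (-1) ^ card (inversions I) * a (nths (v # vs) I) * b (nths (v # vs) (- I))"
  let ?P = "Pow {..<length vs}"
  have fin: "finite I" if "I \<in> ?P" for I using that finite_subset by blast
  have "inj_on (\<lambda>I. insert 0 (Suc ` I)) ?P"
    by (rule inj_on_inverseI[where g="\<lambda>J. {i. Suc i \<in> J}"]) auto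
  then have A: "(\<Sum>I\<in>(\<lambda>I. insert 0 (Suc ` I)) ` ?P. ?t I) = shuffle_prod (\<lambda>us. a (v # us)) b vs"
    by (simp only: sum.reindex comp_def shuffle_prod_def card_inversions_insert_0 nths_Cons_Suc_image)
  have "inj_on ((`) Suc) ?P"
    by (rule inj_on_inverseI[where g="\<lambda>J. {i. Suc i \<in> J}"]) auto
  then have "(\<Sum>I\<in>(`) Suc ` ?P. ?t I) = (\<Sum>I\<in>?P. ?t (Suc ` I))"
    by (simp add: sum.reindex)
  also have "\<dots> = shuffle_prod (\<lambda>us. (-1) ^ length us * a us) (\<lambda>us. b (v # us)) vs"
    unfolding shuffle_prod_def
    by (intro sum.cong refl)
      (simp add: card_inversions_Suc[OF fin] length_nths_Pow nths_Cons_Suc_image power_add)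
  finally have B: "(\<Sum>I\<in>(`) Suc ` ?P. ?t I)
      = shuffle_prod (\<lambda>us. (-1) ^ length us * a us) (\<lambda>us. b (v # us)) vs" .
  have "(\<lambda>I. insert 0 (Suc ` I)) ` ?P \<inter> (`) Suc ` ?P = {}"
    by auto
  then have "(\<Sum>I\<in>Pow {..<Suc (length vs)}. ?t I)
      = (\<Sum>I\<in>(\<lambda>I. insert 0 (Suc ` I)) ` ?P. ?t I) + (\<Sum>I\<in>(`) Suc ` ?P. ?t I)"
    unfolding Pow_lessThan_Suc by (intro sum.union_disjoint) auto
  then show ?thesis using A B by (simp add: shuffle_prod_def)
qed

lemma shuffle_prod_add_left:
  "shuffle_prod (\<lambda>us. a us + a' us) b vs = shuffle_prod a b vs + shuffle_prod a' b vs"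
  by (simp add: shuffle_prod_def sum.distrib algebra_simps)

lemma shuffle_prod_add_right:
  "shuffle_prod a (\<lambda>us. b us + b' us) vs = shuffle_prod a b vs + shuffle_prod a b' vs"
  by (simp add: shuffle_prod_def sum.distrib algebra_simps)

lemma shuffle_prod_cmult_left: "shuffle_prod (\<lambda>us. r * a us) b vs = r * shuffle_prod a b vs"
  by (simp add: shuffle_prod_def sum_distrib_left algebra_simps)

lemma shuffle_prod_cmult_right: "shuffle_prod a (\<lambda>us. r * b us) vs = r * shuffle_prod a b vs"
  by (simp add: shuffle_prod_def sum_distrib_left algebra_simps)

lemma shuffle_prod_cong:
  assumes "\<And>us. set us \<subseteq> set vs \<Longrightarrow> a us = a' us" "\<And>us. set us \<subseteq> set vs \<Longrightarrow> b us = b' us"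
  shows "shuffle_prod a b vs = shuffle_prod a' b' vs"
  by (simp add: shuffle_prod_def assms set_nths_subset)

lemma shuffle_prod_map:
  "shuffle_prod a b (map f vs) = shuffle_prod (\<lambda>us. a (map f us)) (\<lambda>us. b (map f us)) vs"
  by (simp add: shuffle_prod_def nths_map)

text \<open>In every shuffle the offending entry lands in one of the two sublists, where that factor
  vanishes.\<close>

lemma shuffle_prod_outside:
  assumes "\<And>us. \<not> set us \<subseteq> T \<Longrightarrow> a us = 0" "\<And>us. \<not> set us \<subseteq> T \<Longrightarrow> b us = 0" "\<not> set vs \<subseteq> T"
  shows "shuffle_prod a b vs = 0"
  unfolding shuffle_prod_def
proof (intro sum.neutral ballI)
  fix I
  obtain i where i: "i < length vs" "vs ! i \<notin> T"
    using assms(3) by (auto simp: set_conv_nth)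
  then have "vs ! i \<in> set (nths vs I) \<or> vs ! i \<in> set (nths vs (- I))"
    by (auto simp: set_nths)
  then show "(- 1) ^ card (inversions I) * a (nths vs I) * b (nths vs (- I)) = 0"
    using i assms by (metis mult_zero_left mult_zero_right subset_iff)
qed

text \<open>The three lists in the multilinearity identity have equal length, so the sign factors
  out. The twist comes from \<open>shuffle_prod_Cons\<close>, and the inductions on shuffle products
  have to absorb it.\<close>

lemma multilinear_on_parity:
  "multilinear_on comb T a \<Longrightarrow> multilinear_on comb T (\<lambda>us. (-1) ^ length us * a us)"
  by (simp add: multilinear_on_def algebra_simps)

lemma alternating_on_parity:
  "alternating_on T a \<Longrightarrow> alternating_on T (\<lambda>us. (-1) ^ length us * a us)"
  by (simp add: alternating_on_def)

lemma shuffle_prod_multilinear: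
  assumes "multilinear_on comb T a" "multilinear_on comb T b"
  shows "multilinear_on comb T (shuffle_prod a b)"
proof -
  have "shuffle_prod a b (us @ comb u r v # ws)
      = shuffle_prod a b (us @ u # ws) + r * shuffle_prod a b (us @ v # ws)"
    if "set us \<subseteq> T" "set ws \<subseteq> T" "u \<in> T" "v \<in> T" for us ws u v r
    using assms that
  proof (induction us arbitrary: a b)
    case Nil
    have "c (comb u r v # us) = c (u # us) + r * c (v # us)"
      if "multilinear_on comb T c" "set us \<subseteq> set ws" for c us
      using multilinear_onD[OF that(1), of "[]" us u v r] that Nil.prems by auto
    then have "shuffle_prod (\<lambda>us. a (comb u r v # us)) b ws
          = shuffle_prod (\<lambda>us. a (u # us) + r * a (v # us)) b ws"
      "shuffle_prod c (\<lambda>us. b (comb u r v # us)) ws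
          = shuffle_prod c (\<lambda>us. b (u # us) + r * b (v # us)) ws" for c
      using Nil by (auto intro!: shuffle_prod_cong)
    then show ?case
      by (simp add: shuffle_prod_Cons shuffle_prod_add_left shuffle_prod_add_right
          shuffle_prod_cmult_left shuffle_prod_cmult_right algebra_simps)
  next
    case (Cons x us)
    have x: "x \<in> T" "set us \<subseteq> T" using Cons.prems by auto
    note 1 = Cons.IH[OF multilinear_on_Cons[OF Cons.prems(1) x(1)] Cons.prems(2) x(2) Cons.prems(4-)]
      and 2 = Cons.IH[OF multilinear_on_parity[OF Cons.prems(1)]
        multilinear_on_Cons[OF Cons.prems(2) x(1)] x(2) Cons.prems(4-)]
    show ?case
      unfolding append_Cons shuffle_prod_Cons[of _ _ x] 1 2 by (simp only: algebra_simps)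
  qed
  then show ?thesis by (simp add: multilinear_on_def)
qed

text \<open>Two equal leading arguments can be distributed in four ways: both to one factor gives
  zero, and the two mixed ways cancel.\<close>

lemma shuffle_prod_alternating:
  assumes "alternating_on T a" "alternating_on T b"
  shows "alternating_on T (shuffle_prod a b)"
proof -
  have "shuffle_prod a b (us @ u # u # ws) = 0"
    if "set us \<subseteq> T" "set ws \<subseteq> T" "u \<in> T" for us ws u
    using assms that
  proof (induction us arbitrary: a b)
    case Nil
    have z: "c (u # u # us) = 0" if "alternating_on T c" "set us \<subseteq> set ws" for c us
      using alternating_onD[OF that(1), of "[]" us u] that Nil.prems by simp
    have "shuffle_prod (\<lambda>us. a (u # u # us)) b ws = shuffle_prod (\<lambda>us. 0 * a us) b ws"
      by (intro shuffle_prod_cong) (simp_all add: z[OF Nil.prems(1)])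
    then have 1: "shuffle_prod (\<lambda>us. a (u # u # us)) b ws = 0"
      by (simp only: shuffle_prod_cmult_left[of 0] mult_zero_left[of "shuffle_prod _ _ _"])
    have "shuffle_prod c (\<lambda>us. b (u # u # us)) ws = shuffle_prod c (\<lambda>us. 0 * b us) ws" for c
      by (intro shuffle_prod_cong) (simp_all add: z[OF Nil.prems(2)])
    then have 2: "shuffle_prod c (\<lambda>us. b (u # u # us)) ws = 0" for c
      by (simp only: shuffle_prod_cmult_right[of _ 0] mult_zero_left[of "shuffle_prod _ _ _"])
    \<comment> \<open>The two mixed terms differ in whether the twist counts the copy of u already
      given to a; that is one factor -1.\<close>
    have "(\<lambda>us. (-1) ^ length (u # us) * a (u # us)) = (\<lambda>us. -1 * ((-1) ^ length us * a (u # us)))"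
      by simp
    then have 3: "shuffle_prod (\<lambda>us. (-1) ^ length (u # us) * a (u # us)) (\<lambda>us. b (u # us)) ws
        = -1 * shuffle_prod (\<lambda>us. (-1) ^ length us * a (u # us)) (\<lambda>us. b (u # us)) ws"
      by (simp only: shuffle_prod_cmult_left)
    show ?case
      unfolding append_Nil shuffle_prod_Cons 1 2 3 by simp
  next
    case (Cons x us)
    have x: "x \<in> T" "set us \<subseteq> T" using Cons.prems by auto
    note 1 = Cons.IH[OF alternating_on_Cons[OF Cons.prems(1) x(1)] Cons.prems(2) x(2) Cons.prems(4-)]
      and 2 = Cons.IH[OF alternating_on_parity[OF Cons.prems(1)]
        alternating_on_Cons[OF Cons.prems(2) x(1)] x(2) Cons.prems(4-)]
    show ?case
      unfolding append_Cons shuffle_prod_Cons[of _ _ x] 1 2 by simp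
  qed
  then show ?thesis by (simp add: alternating_on_def)
qed

text \<open>
  The Leibniz rule, separated from its analytic content: \<open>a' u us\<close> stands for the derivative of
  \<open>a us\<close> in direction \<open>u\<close>.
\<close>

lemma altsum_shuffle_prod:
  "altsum (\<lambda>u us. shuffle_prod (a' u) b us + shuffle_prod a (b' u) us) ws =
     shuffle_prod (altsum a') b ws + shuffle_prod (\<lambda>us. (-1) ^ length us * a us) (altsum b') ws"
proof (induction ws arbitrary: a a' b b')
  case (Cons v ws)
  let ?s = "\<lambda>a us. (-1) ^ length us * a us"
  have minus: "(\<lambda>us. ?s a (v # us)) = (\<lambda>us. -1 * ?s (\<lambda>us. a (v # us)) us)" for a :: "'a list \<Rightarrow> real"
    by auto
  \<comment> \<open>The second use of the induction hypothesis has the twisted first factor, and the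
    twist that it adds cancels the one already there.\<close>
  have ss: "(\<lambda>us. ?s (?s a) us) = a" for a :: "'a list \<Rightarrow> real"
    by (auto simp flip: mult.assoc power_add mult_2)
  have par: "altsum (\<lambda>u. ?s (a' u)) = (\<lambda>us. -1 * ?s (altsum a') us)"
    by (simp add: altsum_parity fun_eq_iff)
  have neg: "altsum \<phi> (v # us) = \<phi> v us + -1 * altsum (\<lambda>u us. \<phi> u (v # us)) us" for \<phi> us
    by simp
  \<comment> \<open>Splitting v off the inner products leaves two sums of the shape of the induction
    hypothesis: v is given to the first factor, or to the second with the first one twisted.\<close>
  have "altsum (\<lambda>u us. shuffle_prod (a' u) b (v # us) + shuffle_prod a (b' u) (v # us)) ws
    = altsum (\<lambda>u us. (shuffle_prod (\<lambda>us. a' u (v # us)) b us + shuffle_prod (\<lambda>us. a (v # us)) (b' u) us)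
       + (shuffle_prod (?s (a' u)) (\<lambda>us. b (v # us)) us + shuffle_prod (?s a) (\<lambda>us. b' u (v # us)) us)) ws"
    by (simp add: shuffle_prod_Cons algebra_simps)
  also have "\<dots> = shuffle_prod (altsum (\<lambda>u us. a' u (v # us))) b ws
      + shuffle_prod (?s (\<lambda>us. a (v # us))) (altsum b') ws
      + (shuffle_prod (\<lambda>us. -1 * ?s (altsum a') us) (\<lambda>us. b (v # us)) ws
      + shuffle_prod a (altsum (\<lambda>u us. b' u (v # us))) ws)"
    unfolding altsum_add
    using Cons.IH[of "\<lambda>u us. a' u (v # us)" b "\<lambda>us. a (v # us)" b']
      Cons.IH[of "\<lambda>u. ?s (a' u)" "\<lambda>us. b (v # us)" "?s a" "\<lambda>u us. b' u (v # us)"]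
    by (simp only: altsum_add ss par)
  finally have E: "altsum (\<lambda>u us. shuffle_prod (a' u) b (v # us) + shuffle_prod a (b' u) (v # us)) ws = \<dots>" .
  show ?case
    unfolding altsum_Cons[of _ v ws] E
    unfolding shuffle_prod_Cons[of _ _ v ws] minus ss neg
      shuffle_prod_add_left shuffle_prod_add_right shuffle_prod_cmult_left shuffle_prod_cmult_right
    by simp
qed simp

text \<open>
  For multilinear \<open>h\<close> and vectors with derivatives \<open>(a, b)\<close>, the product-rule derivative of \<open>h\<close> at the
  list of the \<open>a\<close>.
\<close>

fun subst_sum :: "('v list \<Rightarrow> real) \<Rightarrow> ('v \<times> 'v) list \<Rightarrow> real" where
  "subst_sum h [] = 0"
| "subst_sum h ((a, b) # ps) = h (b # map fst ps) + subst_sum (\<lambda>us. h (a # us)) ps"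

text \<open>Moving the replaced entry from position i to the front takes i transpositions, which is
  the sign (-1)^i of \<open>altsum\<close>.\<close>

lemma subst_sum_altsum:
  assumes T: "\<And>u v r. u \<in> T \<Longrightarrow> v \<in> T \<Longrightarrow> comb u r v \<in> T"
    and "multilinear_on comb T h" "alternating_on T h"
    and "A ` set ws \<subseteq> T" "b ` set ws \<subseteq> T"
  shows "subst_sum h (map (\<lambda>w. (A w, b w)) ws) = altsum (\<lambda>u us. h (b u # map A us)) ws"
  using assms(2-)
proof (induction ws arbitrary: h)
  case (Cons w ws)
  have "subst_sum (\<lambda>us. h (A w # us)) (map (\<lambda>w. (A w, b w)) ws)
      = altsum (\<lambda>u us. h (A w # b u # map A us)) ws"
    by (rule Cons.IH) (use Cons.prems in \<open>auto intro: multilinear_on_Cons alternating_on_Cons\<close>)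
  also have "\<dots> = altsum (\<lambda>u us. -1 * h (b u # A w # map A us)) ws"
  proof (rule altsum_cong[of _ "set ws"])
    fix u us assume "u \<in> set ws" "set us \<subseteq> set ws"
    then show "h (A w # b u # map A us) = -1 * h (b u # A w # map A us)"
      using alternating_on_swap[OF T Cons.prems(1,2), of "[]" "map A us" "A w" "b u"] Cons.prems
      by auto
  qed simp
  also have "\<dots> = -1 * altsum (\<lambda>u us. h (b u # A w # map A us)) ws"
    by (rule altsum_cmult)
  finally show ?case by (simp add: comp_def)
qed simp

text \<open>A pair of entries occurs twice, once with each entry as the direction and the other one
  replaced, and with opposite signs. In the application B is the second derivative of a coordinate
  change.\<close>

lemma altsum_subst_sum_symmetric:
  assumes T: "\<And>u v r. u \<in> T \<Longrightarrow> v \<in> T \<Longrightarrow> comb u r v \<in> T"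
    and "multilinear_on comb T h" "alternating_on T h"
    and "A ` set ws \<subseteq> T" "\<And>u v. u \<in> set ws \<Longrightarrow> v \<in> set ws \<Longrightarrow> B u v \<in> T"
    and sym: "\<And>u v. u \<in> set ws \<Longrightarrow> v \<in> set ws \<Longrightarrow> B u v = B v u"
  shows "altsum (\<lambda>u us. subst_sum h (map (\<lambda>w. (A w, B u w)) us)) ws = 0"
  using assms(2-)
proof (induction ws arbitrary: h)
  case (Cons w ws)
  \<comment> \<open>These are the terms with w as direction; after use of symmetry they match the
    terms in which w is the replaced entry.\<close>
  have 1: "subst_sum h (map (\<lambda>x. (A x, B w x)) ws) = altsum (\<lambda>u us. h (B w u # map A us)) ws"
    by (rule subst_sum_altsum[OF T]) (use Cons.prems in auto)
  also have "\<dots> = altsum (\<lambda>u us. h (B u w # map A us)) ws"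
    by (rule altsum_cong[of _ "set ws"]) (use Cons.prems(5)[of w] in auto)
  finally have 1: "subst_sum h (map (\<lambda>x. (A x, B w x)) ws) = altsum (\<lambda>u us. h (B u w # map A us)) ws" .
  have 2: "altsum (\<lambda>u us. subst_sum (\<lambda>us. h (A w # us)) (map (\<lambda>w. (A w, B u w)) us)) ws = 0"
    by (rule Cons.IH) (use Cons.prems in \<open>auto intro: multilinear_on_Cons alternating_on_Cons\<close>)
  show ?case using 1 2 by (simp add: altsum_add comp_def)
qed simp

section \<open>Calculus within a linear subspace\<close>

locale relatively_open =
  fixes V W :: "'a::euclidean_space set"
  assumes subspace_V: "subspace V" and openin_W: "openin (top_of_set V) W"
begin

lemma W_subset: "W \<subseteq> V"
  using openin_W openin_imp_subset by blast

text \<open>W is a neighbourhood of x relative to V. The definitions differentiate within V, while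
  functions are controlled only on W.\<close>

lemma at_within_W: "x \<in> W \<Longrightarrow> at x within V = at x within W"
proof -
  assume x: "x \<in> W"
  obtain U where "open U" "W = V \<inter> U"
    using openin_W by (auto simp: openin_open)
  then show ?thesis
    using x by (intro at_within_nhd[of x U]) auto
qed

text \<open>A line in a direction of V through a point of V stays in V, so derivatives within V
  become ordinary derivatives in one real variable. Uniqueness and the mean value theorem are
  accessible in this way.\<close>

lemma has_derivative_along_line:
  assumes "x \<in> V" "v \<in> V" "(f has_derivative f') (at (x + t *\<^sub>R v) within V)"
  shows "((\<lambda>t. f (x + t *\<^sub>R v)) has_derivative (\<lambda>h. h *\<^sub>R f' v)) (at t)"
proof -
  have "(\<lambda>t. x + t *\<^sub>R v) ` UNIV \<subseteq> V"
    using assms subspace_V by (auto intro: subspace_add subspace_mul)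
  then have f: "(f has_derivative f') (at (x + t *\<^sub>R v) within (\<lambda>t. x + t *\<^sub>R v) ` UNIV)"
    using assms(3) has_derivative_subset by blast
  have "((\<lambda>t. x + t *\<^sub>R v) has_derivative (\<lambda>h. h *\<^sub>R v)) (at t)"
    by (auto intro!: derivative_eq_intros)
  from has_derivative_in_compose[OF this f]
  show ?thesis
    using linear_cmul[OF has_derivative_linear[OF assms(3)]] by simp
qed

text \<open>Off V a derivative within V is arbitrary; on V it is read off along lines.\<close>

lemma has_derivative_unique_on:
  assumes "x \<in> V" "v \<in> V" "(f has_derivative f') (at x within V)" "(f has_derivative f'') (at x within V)"
  shows "f' v = f'' v"
proof -
  have "((\<lambda>t. f (x + t *\<^sub>R v)) has_derivative (\<lambda>h. h *\<^sub>R f' v)) (at 0)"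
    "((\<lambda>t. f (x + t *\<^sub>R v)) has_derivative (\<lambda>h. h *\<^sub>R f'' v)) (at 0)"
    using assms by (auto intro!: has_derivative_along_line)
  then have "(\<lambda>h. h *\<^sub>R f' v) = (\<lambda>h. h *\<^sub>R f'' v)"
    by (rule has_derivative_unique)
  from fun_cong[OF this, of 1] show ?thesis by simp
qed

lemma frechet_derivative_eq:
  assumes "x \<in> W" "v \<in> V" "(f has_derivative f') (at x within V)"
  shows "frechet_derivative f (at x within V) v = f' v"
  using assms W_subset
  by (metis differentiableI frechet_derivative_works has_derivative_unique_on subsetD)

lemma has_derivative_cong_on:
  assumes "x \<in> W" "\<And>y. y \<in> W \<Longrightarrow> f y = g y" "(f has_derivative f') (at x within V)"
  shows "(g has_derivative f') (at x within V)"
  using has_derivative_transform[of x W g f f'] assms by (simp add: at_within_W)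

text \<open>The equality extends to vectors off V, because both choices are made from the same set
  of derivatives.\<close>

lemma frechet_derivative_cong_on:
  assumes "x \<in> W" "\<And>y. y \<in> W \<Longrightarrow> f y = g y"
  shows "frechet_derivative f (at x within V) = frechet_derivative g (at x within V)"
proof -
  have "(f has_derivative f') (at x within V) \<longleftrightarrow> (g has_derivative f') (at x within V)" for f'
    using has_derivative_cong_on[OF assms(1)] assms(2) by metis
  then show ?thesis by (simp add: frechet_derivative_def)
qed

text \<open>A linear retraction onto V: its fixed points are the vectors of V, and its values on the
  standard basis span V, so that no basis of V has to be chosen.\<close>

lemma projection_exists:
  obtains P :: "'a \<Rightarrow> 'a" where "linear P" "range P \<subseteq> V" "\<forall>x\<in>V. P x = x"
  using linear_exists_left_inverse_on[of id V] subspace_V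
  by (metis id_apply inj_on_id linear_id)

lemma has_derivative_compose_on:
  assumes "x \<in> W" "\<tau> ` W \<subseteq> V" "(\<tau> has_derivative \<tau>') (at x within V)"
    "(g has_derivative g') (at (\<tau> x) within V)"
  shows "((\<lambda>x. g (\<tau> x)) has_derivative (\<lambda>h. g' (\<tau>' h))) (at x within V)"
  using assms unfolding at_within_W[OF assms(1)]
  by (blast intro: has_derivative_in_compose has_derivative_subset)

text \<open>The retraction P fixes the values of \<tau> on W, so \<tau> and P \<circ> \<tau> have
  the same derivative on V, and P takes values in V.\<close>

lemma has_derivative_into_V:
  assumes "x \<in> W" "\<tau> ` W \<subseteq> V" "(\<tau> has_derivative \<tau>') (at x within V)" "h \<in> V"
  shows "\<tau>' h \<in> V"
proof -
  obtain P where P: "linear P" "range P \<subseteq> V" "\<forall>x\<in>V. P x = x"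
    by (rule projection_exists)
  have "((\<lambda>x. P (\<tau> x)) has_derivative (\<lambda>h. P (\<tau>' h))) (at x within V)"
    using bounded_linear.has_derivative[OF _ assms(3)] P(1) by (simp add: linear_conv_bounded_linear)
  moreover have "\<tau> y = P (\<tau> y)" if "y \<in> W" for y
    using P(3) assms(2) that by (simp add: image_subset_iff)
  then have "((\<lambda>x. P (\<tau> x)) has_derivative \<tau>') (at x within V)"
    by (rule has_derivative_cong_on[OF assms(1) _ assms(3)])
  ultimately have "P (\<tau>' h) = \<tau>' h"
    using has_derivative_unique_on assms(1,4) W_subset by blast
  then show ?thesis using P(2) by (metis rangeI subsetD)
qed

section \<open>Closure properties of smooth functions\<close>

lemma Ck_on_cong:
  "Ck_on k V W f \<Longrightarrow> (\<And>x. x \<in> W \<Longrightarrow> f x = g x) \<Longrightarrow> Ck_on k V W g"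
proof (induction k arbitrary: f g)
  case 0
  then show ?case using continuous_on_cong by fastforce
next
  case (Suc k)
  show ?case
    unfolding Ck_on.simps(2)
  proof (intro conjI ballI)
    fix x assume x: "x \<in> W"
    then have "(f has_derivative frechet_derivative f (at x within V)) (at x within V)"
      using Suc.prems(1) by (auto simp flip: frechet_derivative_works)
    from has_derivative_cong_on[OF x Suc.prems(2) this]
    show "g differentiable (at x within V)" by (auto intro: differentiableI)
  next
    fix v assume "v \<in> V"
    then have "Ck_on k V W (\<lambda>x. frechet_derivative f (at x within V) v)"
      using Suc.prems(1) by simp
    then show "Ck_on k V W (\<lambda>x. frechet_derivative g (at x within V) v)"
      by (rule Suc.IH) (simp add: frechet_derivative_cong_on[OF _ Suc.prems(2)])
  qed
qed

text \<open>Any derivative at hand may replace the chosen \<open>frechet_derivative\<close>, since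
  the two agree on V.\<close>

lemma Ck_on_Suc_intro:
  assumes "\<And>x. x \<in> W \<Longrightarrow> (f has_derivative f' x) (at x within V)"
    and "\<And>v. v \<in> V \<Longrightarrow> Ck_on k V W (\<lambda>x. f' x v)"
  shows "Ck_on (Suc k) V W f"
proof -
  have "Ck_on k V W (\<lambda>x. frechet_derivative f (at x within V) v)" if v: "v \<in> V" for v
    by (rule Ck_on_cong[OF assms(2)[OF v]]) (simp add: frechet_derivative_eq[OF _ v assms(1)])
  then show ?thesis using assms(1) by (auto intro: differentiableI)
qed

lemma Ck_on_Suc_elim:
  assumes "Ck_on (Suc k) V W f"
  obtains f' where "\<And>x. x \<in> W \<Longrightarrow> (f has_derivative f' x) (at x within V)"
    "\<And>v. v \<in> V \<Longrightarrow> Ck_on k V W (\<lambda>x. f' x v)"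
  using assms by (force simp: frechet_derivative_works)

lemma Ck_on_SucD: "Ck_on (Suc k) V W f \<Longrightarrow> Ck_on k V W f"
proof (induction k arbitrary: f)
  case 0
  then have "continuous (at x within W) f" if "x \<in> W" for x
    using that differentiable_imp_continuous_within[of f x V] by (simp add: at_within_W)
  then show ?case by (simp add: continuous_on_eq_continuous_within)
next
  case (Suc k)
  then show ?case by (simp del: Ck_on.simps(1))
qed

lemma Ck_on_const: "Ck_on k V W (\<lambda>x. c)"
proof (induction k arbitrary: c)
  case (Suc k)
  show ?case by (rule Ck_on_Suc_intro[where f'="\<lambda>_ _. 0"]) (auto intro: Suc.IH simp del: Ck_on.simps)
qed simp

lemma Ck_on_linear:
  assumes "bounded_linear L"
  shows "Ck_on k V W f \<Longrightarrow> Ck_on k V W (\<lambda>x. L (f x))"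
proof (induction k arbitrary: f)
  case 0
  then show ?case using assms by (simp add: bounded_linear.continuous_on)
next
  case (Suc k)
  from Suc.prems obtain f' where f': "\<And>x. x \<in> W \<Longrightarrow> (f has_derivative f' x) (at x within V)"
    "\<And>v. v \<in> V \<Longrightarrow> Ck_on k V W (\<lambda>x. f' x v)"
    by (rule Ck_on_Suc_elim) blast
  show ?case
    by (rule Ck_on_Suc_intro) (use f' Suc.IH assms bounded_linear.has_derivative in blast)+
qed

lemma Ck_on_add: "Ck_on k V W f \<Longrightarrow> Ck_on k V W g \<Longrightarrow> Ck_on k V W (\<lambda>x. f x + g x)"
proof (induction k arbitrary: f g)
  case 0
  then show ?case by (simp add: continuous_on_add)
next
  case (Suc k)
  from Suc.prems(1) obtain f' where f': "\<And>x. x \<in> W \<Longrightarrow> (f has_derivative f' x) (at x within V)"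
    "\<And>v. v \<in> V \<Longrightarrow> Ck_on k V W (\<lambda>x. f' x v)"
    by (rule Ck_on_Suc_elim) blast
  from Suc.prems(2) obtain g' where g': "\<And>x. x \<in> W \<Longrightarrow> (g has_derivative g' x) (at x within V)"
    "\<And>v. v \<in> V \<Longrightarrow> Ck_on k V W (\<lambda>x. g' x v)"
    by (rule Ck_on_Suc_elim) blast
  show ?case
    by (rule Ck_on_Suc_intro) (use f' g' Suc.IH has_derivative_add in blast)+
qed

lemma Ck_on_bilinear:
  fixes prod :: "'b::euclidean_space \<Rightarrow> 'c::euclidean_space \<Rightarrow> 'd::euclidean_space"
  assumes "bounded_bilinear prod"
  shows "Ck_on k V W f \<Longrightarrow> Ck_on k V W g \<Longrightarrow> Ck_on k V W (\<lambda>x. prod (f x) (g x))"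
proof (induction k arbitrary: f g)
  case 0
  then show ?case using assms by (simp add: bounded_bilinear.continuous_on)
next
  case (Suc k)
  from Suc.prems(1) obtain f' where f': "\<And>x. x \<in> W \<Longrightarrow> (f has_derivative f' x) (at x within V)"
    "\<And>v. v \<in> V \<Longrightarrow> Ck_on k V W (\<lambda>x. f' x v)"
    by (rule Ck_on_Suc_elim) blast
  from Suc.prems(2) obtain g' where g': "\<And>x. x \<in> W \<Longrightarrow> (g has_derivative g' x) (at x within V)"
    "\<And>v. v \<in> V \<Longrightarrow> Ck_on k V W (\<lambda>x. g' x v)"
    by (rule Ck_on_Suc_elim) blast
  show ?case
  proof (rule Ck_on_Suc_intro)
    show "((\<lambda>x. prod (f x) (g x)) has_derivative (\<lambda>h. prod (f x) (g' x h) + prod (f' x h) (g x)))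
        (at x within V)" if "x \<in> W" for x
      using bounded_bilinear.FDERIV[OF assms] f'(1) g'(1) that by blast
    \<comment> \<open>The undifferentiated factors have order \<open>Suc k\<close> and are lowered
      to order k before the induction hypothesis applies.\<close>
    show "Ck_on k V W (\<lambda>x. prod (f x) (g' x v) + prod (f' x v) (g x))" if "v \<in> V" for v
      using that f'(2) g'(2) Suc.prems by (intro Ck_on_add Suc.IH) (blast intro: Ck_on_SucD)+
  qed
qed

lemma smooth_on_cong: "smooth_on V W f \<Longrightarrow> (\<And>x. x \<in> W \<Longrightarrow> f x = g x) \<Longrightarrow> smooth_on V W g"
  unfolding smooth_on_def using Ck_on_cong by blast

lemma smooth_on_const: "smooth_on V W (\<lambda>x. c)"
  by (simp add: smooth_on_def Ck_on_const)

lemma smooth_on_add: "smooth_on V W f \<Longrightarrow> smooth_on V W g \<Longrightarrow> smooth_on V W (\<lambda>x. f x + g x)"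
  by (simp add: smooth_on_def Ck_on_add)

lemma smooth_on_mult:
  fixes f g :: "'a \<Rightarrow> real"
  shows "smooth_on V W f \<Longrightarrow> smooth_on V W g \<Longrightarrow> smooth_on V W (\<lambda>x. f x * g x)"
  by (simp add: smooth_on_def Ck_on_bilinear[OF bounded_bilinear_mult])

lemma smooth_on_scaleR:
  "smooth_on V W f \<Longrightarrow> smooth_on V W g \<Longrightarrow> smooth_on V W (\<lambda>x. f x *\<^sub>R g x)"
  by (simp add: smooth_on_def Ck_on_bilinear[OF bounded_bilinear_scaleR])

lemma smooth_on_sum:
  "(\<And>i. i \<in> I \<Longrightarrow> smooth_on V W (f i)) \<Longrightarrow> smooth_on V W (\<lambda>x. \<Sum>i\<in>I. f i x)"
  by (induction I rule: infinite_finite_induct) (auto intro: smooth_on_const smooth_on_add)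

lemma smooth_on_differentiable:
  "smooth_on V W f \<Longrightarrow> x \<in> W \<Longrightarrow>
    (f has_derivative frechet_derivative f (at x within V)) (at x within V)"
  unfolding smooth_on_def using Ck_on.simps(2) frechet_derivative_works by blast

lemma smooth_on_derivative:
  "smooth_on V W f \<Longrightarrow> v \<in> V \<Longrightarrow> smooth_on V W (\<lambda>x. frechet_derivative f (at x within V) v)"
  unfolding smooth_on_def using Ck_on.simps(2) by blast

text \<open>Derivatives are taken within V, not within S, so shrinking S affects only the points
  considered.\<close>

lemma Ck_on_mono: "Ck_on k V S f \<Longrightarrow> S' \<subseteq> S \<Longrightarrow> Ck_on k V S' f"
  by (induction k arbitrary: f) (auto intro: continuous_on_subset)

lemma smooth_on_subset: "smooth_on V S f \<Longrightarrow> S' \<subseteq> S \<Longrightarrow> smooth_on V S' f"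
  unfolding smooth_on_def using Ck_on_mono by blast

section \<open>Symmetry of second derivatives\<close>

text \<open>The mean value theorem is applied twice, along u to a difference of values of f and then
  along v to the derivative in direction u. The hypothesis \<open>par\<close> keeps the whole
  parallelogram in W.\<close>

lemma second_difference:
  fixes f :: "'a \<Rightarrow> real"
  assumes f: "\<And>y. y \<in> W \<Longrightarrow> (f has_derivative f' y) (at y within V)"
    and f': "\<And>y. y \<in> W \<Longrightarrow> ((\<lambda>y. f' y u) has_derivative g y) (at y within V)"
    and "x \<in> W" "u \<in> V" "v \<in> V" "0 < t"
    and par: "\<And>s r. 0 \<le> s \<Longrightarrow> s \<le> t \<Longrightarrow> 0 \<le> r \<Longrightarrow> r \<le> t \<Longrightarrow> x + s *\<^sub>R u + r *\<^sub>R v \<in> W"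
  shows "\<exists>s r. 0 < s \<and> s < t \<and> 0 < r \<and> r < t \<and>
    f (x + t *\<^sub>R u + t *\<^sub>R v) - f (x + t *\<^sub>R u) - f (x + t *\<^sub>R v) + f x
      = t\<^sup>2 * g (x + s *\<^sub>R u + r *\<^sub>R v) v"
proof -
  have x: "x \<in> V" using \<open>x \<in> W\<close> W_subset by blast
  define \<phi> where "\<phi> s = f (x + t *\<^sub>R v + s *\<^sub>R u) - f (x + s *\<^sub>R u)" for s
  have "DERIV \<phi> s :> f' (x + s *\<^sub>R u + t *\<^sub>R v) u - f' (x + s *\<^sub>R u) u" if "0 \<le> s" "s \<le> t" for s
  proof -
    have "(f has_derivative f' (x + s *\<^sub>R u + t *\<^sub>R v)) (at (x + t *\<^sub>R v + s *\<^sub>R u) within V)"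
      using f[OF par[of s t]] that \<open>0 < t\<close> by (simp add: algebra_simps)
    moreover have "x + t *\<^sub>R v \<in> V"
      using x \<open>v \<in> V\<close> subspace_V by (auto intro: subspace_add subspace_mul)
    ultimately have 1: "((\<lambda>s. f (x + t *\<^sub>R v + s *\<^sub>R u)) has_derivative
        (\<lambda>h. h *\<^sub>R f' (x + s *\<^sub>R u + t *\<^sub>R v) u)) (at s)"
      using \<open>u \<in> V\<close> by (intro has_derivative_along_line) auto
    have "(f has_derivative f' (x + s *\<^sub>R u)) (at (x + s *\<^sub>R u) within V)"
      using f[OF par[of s 0]] that \<open>0 < t\<close> by simp
    then have 2: "((\<lambda>s. f (x + s *\<^sub>R u)) has_derivative (\<lambda>h. h *\<^sub>R f' (x + s *\<^sub>R u) u)) (at s)"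
      using \<open>u \<in> V\<close> x by (intro has_derivative_along_line) auto
    show ?thesis
      using has_derivative_diff[OF 1 2] unfolding \<phi>_def has_field_derivative_def
      by (auto elim!: has_derivative_eq_rhs simp: algebra_simps)
  qed
  from MVT2[OF \<open>0 < t\<close> this]
  obtain s where s: "0 < s" "s < t"
    "\<phi> t - \<phi> 0 = t * (f' (x + s *\<^sub>R u + t *\<^sub>R v) u - f' (x + s *\<^sub>R u) u)"
    by auto
  have "DERIV (\<lambda>r. f' (x + s *\<^sub>R u + r *\<^sub>R v) u) r :> g (x + s *\<^sub>R u + r *\<^sub>R v) v"
    if "0 \<le> r" "r \<le> t" for r
  proof -
    have "x + s *\<^sub>R u \<in> V"
      using x \<open>u \<in> V\<close> subspace_V by (auto intro: subspace_add subspace_mul)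
    then have "((\<lambda>r. f' (x + s *\<^sub>R u + r *\<^sub>R v) u) has_derivative
        (\<lambda>h. h *\<^sub>R g (x + s *\<^sub>R u + r *\<^sub>R v) v)) (at r)"
      using f'[OF par[of s r]] that s \<open>v \<in> V\<close> by (intro has_derivative_along_line) auto
    then show ?thesis by (auto elim!: has_derivative_eq_rhs simp: has_field_derivative_def)
  qed
  from MVT2[OF \<open>0 < t\<close> this]
  obtain r where r: "0 < r" "r < t"
    "f' (x + s *\<^sub>R u + t *\<^sub>R v) u - f' (x + s *\<^sub>R u) u = t * g (x + s *\<^sub>R u + r *\<^sub>R v) v"
    by auto
  have "f (x + t *\<^sub>R u + t *\<^sub>R v) - f (x + t *\<^sub>R u) - f (x + t *\<^sub>R v) + f x = \<phi> t - \<phi> 0"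
    by (simp add: \<phi>_def add.assoc add.commute[of "t *\<^sub>R u"])
  also have "\<dots> = t\<^sup>2 * g (x + s *\<^sub>R u + r *\<^sub>R v) v"
    using s(3) r(3) by (simp add: power2_eq_square)
  finally have eq: "f (x + t *\<^sub>R u + t *\<^sub>R v) - f (x + t *\<^sub>R u) - f (x + t *\<^sub>R v) + f x
      = t\<^sup>2 * g (x + s *\<^sub>R u + r *\<^sub>R v) v" .
  show ?thesis
    using s(1,2) r(1,2) unfolding eq by blast
qed

text \<open>The second difference is unchanged when u and v are exchanged, so it is t^2 times either
  mixed derivative, each at some point of the parallelogram. For small t continuity puts both within
  e / 2 of their values at x.\<close>

lemma second_derivative_symmetric_real:
  fixes f :: "'a \<Rightarrow> real"
  assumes f: "Ck_on 2 V W f" and x: "x \<in> W" and u: "u \<in> V" and v: "v \<in> V"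
  shows "frechet_derivative (\<lambda>y. frechet_derivative f (at y within V) u) (at x within V) v
    = frechet_derivative (\<lambda>y. frechet_derivative f (at y within V) v) (at x within V) u"
proof -
  let ?D = "\<lambda>f y. frechet_derivative f (at y within V)"
  let ?g = "\<lambda>y. ?D (\<lambda>y. ?D f y u) y v" and ?k = "\<lambda>y. ?D (\<lambda>y. ?D f y v) y u"
  have two: "Ck_on (Suc (Suc 0)) V W f" using f by (simp only: numeral_2_eq_2)
  have D1: "(f has_derivative ?D f y) (at y within V)" if "y \<in> W" for y
    using two that by (auto simp flip: frechet_derivative_works)
  have D2: "((\<lambda>y. ?D f y w) has_derivative ?D (\<lambda>y. ?D f y w) y) (at y within V)"
    if "y \<in> W" "w \<in> V" for y w
    using two that by (auto simp flip: frechet_derivative_works)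
  have cont: "continuous_on W ?g" "continuous_on W ?k"
    using two u v by auto
  have "\<bar>?g x - ?k x\<bar> \<le> e" if "e > 0" for e
  proof -
    obtain d1 where d1: "d1 > 0" "\<And>y. y \<in> W \<Longrightarrow> dist y x < d1 \<Longrightarrow> \<bar>?g y - ?g x\<bar> < e / 2"
      using cont(1)[unfolded continuous_on_iff, rule_format, OF x, of "e / 2"] \<open>e > 0\<close>
      by (auto simp: dist_real_def)
    obtain d2 where d2: "d2 > 0" "\<And>y. y \<in> W \<Longrightarrow> dist y x < d2 \<Longrightarrow> \<bar>?k y - ?k x\<bar> < e / 2"
      using cont(2)[unfolded continuous_on_iff, rule_format, OF x, of "e / 2"] \<open>e > 0\<close>
      by (auto simp: dist_real_def)
    obtain d3 where d3: "d3 > 0" "ball x d3 \<inter> V \<subseteq> W"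
      using openin_W x by (auto simp: openin_contains_ball)
    define d where "d = min d1 (min d2 d3)"
    \<comment> \<open>The added 1 keeps the denominator positive when u = v = 0, and the halving
      makes the distance bound d strict on the parallelogram.\<close>
    define t where "t = d / (norm u + norm v + 1) / 2"
    have pos: "norm u + norm v + 1 > 0" by (simp add: add_nonneg_pos)
    have "d > 0" using d1 d2 d3 by (simp add: d_def)
    then have "t > 0" using pos by (simp add: t_def)
    have "t * (norm u + norm v) < d"
    proof -
      have "t * (norm u + norm v) \<le> t * (norm u + norm v + 1)" using \<open>t > 0\<close> by simp
      also have "\<dots> = d / 2" using pos by (simp add: t_def field_simps)
      finally show ?thesis using \<open>d > 0\<close> by simp
    qed
    have near: "dist (x + s *\<^sub>R u + r *\<^sub>R v) x < d"
      if "0 \<le> s" "s \<le> t" "0 \<le> r" "r \<le> t" for s r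
    proof -
      have "dist (x + s *\<^sub>R u + r *\<^sub>R v) x \<le> s * norm u + r * norm v"
        using norm_triangle_ineq[of "s *\<^sub>R u" "r *\<^sub>R v"] that by (simp add: dist_norm add.assoc)
      also have "\<dots> \<le> t * norm u + t * norm v"
        using that by (intro add_mono mult_right_mono) auto
      finally show ?thesis using \<open>t * (norm u + norm v) < d\<close> by (simp add: algebra_simps)
    qed
    have par: "x + s *\<^sub>R u + r *\<^sub>R v \<in> W" if "0 \<le> s" "s \<le> t" "0 \<le> r" "r \<le> t" for s r
    proof -
      have "x + s *\<^sub>R u + r *\<^sub>R v \<in> V"
        using x W_subset u v subspace_V by (intro subspace_add subspace_mul) auto
      then show ?thesis using near[OF that] d3(2) by (auto simp: d_def dist_commute)
    qed
    have par': "x + s *\<^sub>R v + r *\<^sub>R u \<in> W" if "0 \<le> s" "s \<le> t" "0 \<le> r" "r \<le> t" for s r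
      using par[OF that(3,4,1,2)] by (simp add: algebra_simps)
    have "\<exists>s r. 0 < s \<and> s < t \<and> 0 < r \<and> r < t \<and>
        f (x + t *\<^sub>R u + t *\<^sub>R v) - f (x + t *\<^sub>R u) - f (x + t *\<^sub>R v) + f x
          = t\<^sup>2 * ?g (x + s *\<^sub>R u + r *\<^sub>R v)"
      by (rule second_difference[OF D1 D2[OF _ u]]) (use x u v \<open>t > 0\<close> par in auto)
    then obtain s r where 1: "0 < s" "s < t" "0 < r" "r < t"
      "f (x + t *\<^sub>R u + t *\<^sub>R v) - f (x + t *\<^sub>R u) - f (x + t *\<^sub>R v) + f x
        = t\<^sup>2 * ?g (x + s *\<^sub>R u + r *\<^sub>R v)"
      by blast
    have "\<exists>s r. 0 < s \<and> s < t \<and> 0 < r \<and> r < t \<and>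
        f (x + t *\<^sub>R v + t *\<^sub>R u) - f (x + t *\<^sub>R v) - f (x + t *\<^sub>R u) + f x
          = t\<^sup>2 * ?k (x + s *\<^sub>R v + r *\<^sub>R u)"
      by (rule second_difference[OF D1 D2[OF _ v]]) (use x u v \<open>t > 0\<close> par' in auto)
    then obtain s' r' where 2: "0 < s'" "s' < t" "0 < r'" "r' < t"
      "f (x + t *\<^sub>R v + t *\<^sub>R u) - f (x + t *\<^sub>R v) - f (x + t *\<^sub>R u) + f x
        = t\<^sup>2 * ?k (x + s' *\<^sub>R v + r' *\<^sub>R u)"
      by blast
    have swap: "x + t *\<^sub>R v + t *\<^sub>R u = x + t *\<^sub>R u + t *\<^sub>R v" by simp
    have "t\<^sup>2 * ?g (x + s *\<^sub>R u + r *\<^sub>R v) = t\<^sup>2 * ?k (x + s' *\<^sub>R v + r' *\<^sub>R u)"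
      using 1(5) 2(5)[unfolded swap] by linarith
    then have eq: "?g (x + s *\<^sub>R u + r *\<^sub>R v) = ?k (x + s' *\<^sub>R v + r' *\<^sub>R u)"
      using \<open>t > 0\<close> by simp
    have swap': "x + s' *\<^sub>R v + r' *\<^sub>R u = x + r' *\<^sub>R u + s' *\<^sub>R v" by simp
    have "dist (x + s' *\<^sub>R v + r' *\<^sub>R u) x < d"
      using near[of r' s'] 2(1-4) unfolding swap' by simp
    then have "\<bar>?k (x + s' *\<^sub>R v + r' *\<^sub>R u) - ?k x\<bar> < e / 2"
      using d2(2)[OF par'[of s' r']] 2(1-4) by (simp add: d_def)
    moreover have "\<bar>?g (x + s *\<^sub>R u + r *\<^sub>R v) - ?g x\<bar> < e / 2"
      using d1(2)[OF par[of s r]] near[of s r] 1(1-4) by (simp add: d_def)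
    ultimately show ?thesis using eq by linarith
  qed
  then have "\<bar>?g x - ?k x\<bar> \<le> 0" by (rule field_le_epsilon) simp
  then show ?thesis by simp
qed

text \<open>The mean value theorem concerns real functions, so vector values are treated
  componentwise.\<close>

lemma second_derivative_symmetric:
  fixes f :: "'a \<Rightarrow> 'b::euclidean_space"
  assumes f: "Ck_on 2 V W f" and x: "x \<in> W" and u: "u \<in> V" and v: "v \<in> V"
  shows "frechet_derivative (\<lambda>y. frechet_derivative f (at y within V) u) (at x within V) v
    = frechet_derivative (\<lambda>y. frechet_derivative f (at y within V) v) (at x within V) u"
proof (rule euclidean_eqI)
  fix b :: 'b assume "b \<in> Basis"
  have two: "Ck_on (Suc (Suc 0)) V W f" using f by (simp only: numeral_2_eq_2)
  let ?fb = "\<lambda>x. f x \<bullet> b"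
  have D: "frechet_derivative (\<lambda>y. g y \<bullet> b) (at y within V) w = frechet_derivative g (at y within V) w \<bullet> b"
    if "g differentiable at y within V" "y \<in> W" "w \<in> V" for g :: "'a \<Rightarrow> 'b" and y w
    using that by (intro frechet_derivative_eq)
      (auto simp: frechet_derivative_works intro: has_derivative_inner_left)
  have D2: "frechet_derivative (\<lambda>y. frechet_derivative ?fb (at y within V) w) (at x within V) z
    = frechet_derivative (\<lambda>y. frechet_derivative f (at y within V) w) (at x within V) z \<bullet> b"
    if "w \<in> V" "z \<in> V" for w z
  proof -
    have "frechet_derivative (\<lambda>y. frechet_derivative ?fb (at y within V) w) (at x within V)
      = frechet_derivative (\<lambda>y. frechet_derivative f (at y within V) w \<bullet> b) (at x within V)"
      by (rule frechet_derivative_cong_on[OF x]) (use D two that in auto)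
    then show ?thesis using D[of "\<lambda>y. frechet_derivative f (at y within V) w"] two that x by auto
  qed
  have "Ck_on 2 V W ?fb"
    by (rule Ck_on_linear[OF bounded_linear_inner_left f])
  from second_derivative_symmetric_real[OF this x u v]
  show "frechet_derivative (\<lambda>y. frechet_derivative f (at y within V) u) (at x within V) v \<bullet> b
    = frechet_derivative (\<lambda>y. frechet_derivative f (at y within V) v) (at x within V) u \<bullet> b"
    using D2 u v by simp
qed

end

section \<open>Product rule for multilinear functions with moving arguments\<close>

abbreviation add_scaled :: "'v::real_vector \<Rightarrow> real \<Rightarrow> 'v \<Rightarrow> 'v" where
  "add_scaled u r v \<equiv> u + r *\<^sub>R v"

lemma multilinear_on_sum:
  assumes V: "subspace V" and ml: "multilinear_on add_scaled V F"
    and s: "set us \<subseteq> V" "set ws \<subseteq> V" "finite I" "\<And>i. i \<in> I \<Longrightarrow> b i \<in> V"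
  shows "F (us @ (\<Sum>i\<in>I. c i *\<^sub>R b i) # ws) = (\<Sum>i\<in>I. c i * F (us @ b i # ws))"
  using s(3,4)
proof (induction I)
  case empty
  \<comment> \<open>Writing 0 as \<open>0 + -1 *\<^sub>R 0\<close> turns multilinearity into F = F -
    F at a zero argument.\<close>
  have "F (us @ (0 + -1 *\<^sub>R 0) # ws) = F (us @ 0 # ws) + -1 * F (us @ 0 # ws)"
    by (rule multilinear_onD[OF ml]) (use s V in \<open>auto simp: subspace_0\<close>)
  then show ?case by simp
next
  case (insert i I)
  have "F (us @ ((\<Sum>i\<in>I. c i *\<^sub>R b i) + c i *\<^sub>R b i) # ws)
      = F (us @ (\<Sum>i\<in>I. c i *\<^sub>R b i) # ws) + c i * F (us @ b i # ws)"
    by (rule multilinear_onD[OF ml])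
      (use s V insert in \<open>auto intro!: subspace_sum subspace_mul\<close>)
  then show ?case using insert by (simp add: add.commute)
qed

lemma subst_sum_sum:
  "subst_sum (\<lambda>us. \<Sum>i\<in>I. c i * h i us) ps = (\<Sum>i\<in>I. c i * subst_sum (h i) ps)"
proof (induction ps arbitrary: h)
  case (Cons p ps)
  then show ?case by (cases p) (simp add: sum.distrib distrib_left)
qed simp

lemma subst_sum_cong:
  assumes "\<And>us. set us \<subseteq> T \<Longrightarrow> h us = h' us" "fst ` set ps \<subseteq> T" "snd ` set ps \<subseteq> T"
  shows "subst_sum h ps = subst_sum h' ps"
  using assms
proof (induction ps arbitrary: h h')
  case (Cons p ps)
  obtain a b where p: "p = (a, b)" by fastforce
  have "subst_sum (\<lambda>us. h (a # us)) ps = subst_sum (\<lambda>us. h' (a # us)) ps"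
    by (rule Cons.IH) (use Cons.prems p in auto)
  moreover have "h (b # map fst ps) = h' (b # map fst ps)"
    by (rule Cons.prems(1)) (use Cons.prems p in auto)
  ultimately show ?case by (simp add: p)
qed simp

context relatively_open
begin

text \<open>The multilinearity identity of H is differentiated in the base point, and uniqueness on
  V compares the results. Hence the derivative can be expanded in its arguments as well.\<close>

lemma multilinear_on_derivative:
  assumes "x \<in> W" "h \<in> V"
    and ml: "\<And>y. y \<in> W \<Longrightarrow> multilinear_on add_scaled V (\<lambda>ws. H ws y)"
    and D: "\<And>ws. set ws \<subseteq> V \<Longrightarrow> (H ws has_derivative D ws) (at x within V)"
  shows "multilinear_on add_scaled V (\<lambda>ws. D ws h :: real)"
proof -
  have "D (us @ (u + r *\<^sub>R v) # ws) h = D (us @ u # ws) h + r * D (us @ v # ws) h"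
    if s: "set us \<subseteq> V" "set ws \<subseteq> V" "u \<in> V" "v \<in> V" for us ws u v r
  proof -
    have "((\<lambda>y. H (us @ u # ws) y + r * H (us @ v # ws) y) has_derivative
        (\<lambda>h. D (us @ u # ws) h + r * D (us @ v # ws) h)) (at x within V)"
      using s by (intro has_derivative_add has_derivative_mult_right D) auto
    then have 1: "(H (us @ (u + r *\<^sub>R v) # ws) has_derivative
        (\<lambda>h. D (us @ u # ws) h + r * D (us @ v # ws) h)) (at x within V)"
      by (rule has_derivative_cong_on[OF assms(1), rotated])
        (use multilinear_onD[OF ml s] in simp)
    have "u + r *\<^sub>R v \<in> V" using s subspace_V by (simp add: subspace_add subspace_mul)
    then have 2: "(H (us @ (u + r *\<^sub>R v) # ws) has_derivative D (us @ (u + r *\<^sub>R v) # ws)) (at x within V)"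
      using s by (intro D) auto
    show ?thesis
      using has_derivative_unique_on[OF _ assms(2) 2 1] assms(1) W_subset by blast
  qed
  then show ?thesis by (simp add: multilinear_on_def)
qed

text \<open>
  Expanding the first argument in a spanning family of \<open>V\<close> reduces the statement to the product rule.
\<close>

lemma has_derivative_multilinear:
  fixes H :: "'a list \<Rightarrow> 'a \<Rightarrow> real"
  assumes x: "x \<in> W"
    and "\<And>y. y \<in> W \<Longrightarrow> multilinear_on add_scaled V (\<lambda>ws. H ws y)"
    and "\<And>ws. set ws \<subseteq> V \<Longrightarrow> (H ws has_derivative D ws) (at x within V)"
    and "\<And>p. p \<in> set ps \<Longrightarrow> fst p ` W \<subseteq> V"
    and "\<And>p. p \<in> set ps \<Longrightarrow> (fst p has_derivative snd p) (at x within V)"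
  shows "\<exists>D'. ((\<lambda>y. H (map (\<lambda>p. fst p y) ps) y) has_derivative D') (at x within V) \<and>
    (\<forall>h\<in>V. D' h = D (map (\<lambda>p. fst p x) ps) h
      + subst_sum (\<lambda>ws. H ws x) (map (\<lambda>p. (fst p x, snd p h)) ps))"
  using assms(2-)
proof (induction ps arbitrary: H D)
  case Nil
  show ?case by (rule exI[of _ "D []"]) (use Nil.prems(2)[of "[]"] in simp)
next
  case (Cons p ps)
  obtain P where P: "linear P" "range P \<subseteq> V" "\<forall>x\<in>V. P x = x"
    by (rule projection_exists)
  have PV: "P i \<in> V" for i using P(2) by blast
  have expand: "v = (\<Sum>i\<in>Basis. (v \<bullet> i) *\<^sub>R P i)" if "v \<in> V" for v
  proof -
    have "P v = P (\<Sum>i\<in>Basis. (v \<bullet> i) *\<^sub>R i)"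
      by (simp only: euclidean_representation)
    also have "\<dots> = (\<Sum>i\<in>Basis. (v \<bullet> i) *\<^sub>R P i)"
      by (simp only: linear_sum[OF P(1)] linear_cmul[OF P(1)])
    finally show ?thesis using P(3) that by simp
  qed
  obtain u u' where p: "p = (u, u')" by fastforce
  have u: "u ` W \<subseteq> V" "(u has_derivative u') (at x within V)"
    using Cons.prems(3,4)[of p] p by auto
  have u'V: "u' h \<in> V" if "h \<in> V" for h
    using has_derivative_into_V[OF x u that] .
  have ux: "u y \<in> V" if "y \<in> W" for y using u(1) that by blast
  let ?R = "\<lambda>y. map (\<lambda>p. fst p y) ps"
  have RV: "set (?R y) \<subseteq> V" if "y \<in> W" for y
    using Cons.prems(3) that by fastforce
  let ?S = "\<lambda>h. map (\<lambda>p. (fst p x, snd p h)) ps"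
  have SV: "fst ` set (?S h) \<subseteq> V" "snd ` set (?S h) \<subseteq> V" if h: "h \<in> V" for h
  proof -
    have "fst q x \<in> V" "snd q h \<in> V" if "q \<in> set ps" for q
      using Cons.prems(3)[of q] has_derivative_into_V[OF x Cons.prems(3)[of q] Cons.prems(4)[of q] h] x that
      by (auto simp: image_subset_iff)
    then show "fst ` set (?S h) \<subseteq> V" "snd ` set (?S h) \<subseteq> V" by auto
  qed
  \<comment> \<open>With the first argument frozen at P i, the other arguments fall under the
    induction hypothesis.\<close>
  have "\<forall>i. \<exists>D'. ((\<lambda>y. H (P i # ?R y) y) has_derivative D') (at x within V) \<and>
      (\<forall>h\<in>V. D' h = D (P i # ?R x) h + subst_sum (\<lambda>ws. H (P i # ws) x) (?S h))"
    by (rule allI, rule Cons.IH) (use Cons.prems PV in \<open>auto intro: multilinear_on_Cons\<close>)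
  from choice[OF this] obtain D' where D': "\<And>i. ((\<lambda>y. H (P i # ?R y) y) has_derivative D' i) (at x within V)"
    "\<And>i h. h \<in> V \<Longrightarrow> D' i h = D (P i # ?R x) h + subst_sum (\<lambda>ws. H (P i # ws) x) (?S h)"
    by blast
  let ?E = "\<lambda>h. \<Sum>i\<in>Basis. (u x \<bullet> i) * D' i h + (u' h \<bullet> i) * H (P i # ?R x) x"
  have der: "((\<lambda>y. \<Sum>i\<in>Basis. (u y \<bullet> i) * H (P i # ?R y) y) has_derivative ?E) (at x within V)"
    by (intro has_derivative_sum has_derivative_mult has_derivative_inner_left u D')
  have eq: "(\<Sum>i\<in>Basis. (u y \<bullet> i) * H (P i # ?R y) y) = H (u y # ?R y) y" if "y \<in> W" for y
    using multilinear_on_sum[OF subspace_V Cons.prems(1)[OF that], of "[]" "?R y" Basis P "\<lambda>i. u y \<bullet> i"]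
      RV[OF that] PV expand[OF ux[OF that]] by simp
  have "((\<lambda>y. H (u y # ?R y) y) has_derivative ?E) (at x within V)"
    by (rule has_derivative_cong_on[OF x eq der])
  moreover have "?E h = D (u x # ?R x) h + subst_sum (\<lambda>ws. H ws x) ((u x, u' h) # ?S h)"
    if h: "h \<in> V" for h
  proof -
    have 1: "(\<Sum>i\<in>Basis. (u x \<bullet> i) * D (P i # ?R x) h) = D (u x # ?R x) h"
      using multilinear_on_sum[OF subspace_V multilinear_on_derivative[OF x h Cons.prems(1,2)],
          of "[]" "?R x" Basis P "\<lambda>i. u x \<bullet> i"]
        RV[OF x] PV expand[OF ux[OF x]] by simp
    have 2: "(\<Sum>i\<in>Basis. (u' h \<bullet> i) * H (P i # ?R x) x) = H (u' h # ?R x) x"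
      using multilinear_on_sum[OF subspace_V Cons.prems(1)[OF x], of "[]" "?R x" Basis P "\<lambda>i. u' h \<bullet> i"]
        RV[OF x] PV expand[OF u'V[OF h]] by simp
    have "(\<Sum>i\<in>Basis. (u x \<bullet> i) * subst_sum (\<lambda>ws. H (P i # ws) x) (?S h))
        = subst_sum (\<lambda>ws. \<Sum>i\<in>Basis. (u x \<bullet> i) * H (P i # ws) x) (?S h)"
      by (rule subst_sum_sum[symmetric])
    also have "\<dots> = subst_sum (\<lambda>ws. H (u x # ws) x) (?S h)"
    proof (rule subst_sum_cong[OF _ SV[OF h]])
      fix ws :: "'a list" assume "set ws \<subseteq> V"
      then show "(\<Sum>i\<in>Basis. (u x \<bullet> i) * H (P i # ws) x) = H (u x # ws) x"
        using multilinear_on_sum[OF subspace_V Cons.prems(1)[OF x], of "[]" ws Basis P "\<lambda>i. u x \<bullet> i"]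
          PV expand[OF ux[OF x]] by simp
    qed
    finally have 3: "(\<Sum>i\<in>Basis. (u x \<bullet> i) * subst_sum (\<lambda>ws. H (P i # ws) x) (?S h))
        = subst_sum (\<lambda>ws. H (u x # ws) x) (?S h)" .
    show ?thesis
      using D'(2)[OF h] 1 2 3 by (simp add: sum.distrib distrib_left comp_def)
  qed
  ultimately show ?case unfolding p by auto
qed

end

section \<open>Tangent vectors in charts\<close>

abbreviation tangent_add :: "('m, 'a::euclidean_space) tvec \<Rightarrow> real \<Rightarrow> ('m, 'a) tvec \<Rightarrow> ('m, 'a) tvec" where
  "tangent_add u r v \<equiv> (\<lambda>c. u c + r *\<^sub>R v c)"

locale smooth_mfd =
  fixes M :: "('m, 'a::euclidean_space) manifold"
  assumes smooth_manifold: "smooth_manifold M"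
begin

abbreviation V where "V \<equiv> model M"

lemma subspace_model: "subspace V"
  using smooth_manifold by (simp add: smooth_manifold_def)

lemma add_scaled_model: "u \<in> V \<Longrightarrow> v \<in> V \<Longrightarrow> u + r *\<^sub>R v \<in> V"
  by (simp add: subspace_model subspace_add subspace_mul)

lemma chart_subset: "c \<in> atlas M \<Longrightarrow> fst c \<subseteq> points M"
  using smooth_manifold unfolding smooth_manifold_def by blast

lemma chart_exists: "p \<in> points M \<Longrightarrow> \<exists>c. c \<in> atlas M \<and> p \<in> fst c"
  using smooth_manifold unfolding smooth_manifold_def by blast

lemma chart_at: "p \<in> points M \<Longrightarrow> chart_at M p \<in> atlas M \<and> p \<in> fst (chart_at M p)"
  unfolding chart_at_def by (rule someI_ex[OF chart_exists])

lemma chart_homeomorphic: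
  "c \<in> atlas M \<Longrightarrow> homeomorphic_map (subtopology (mtop M) (fst c)) (top_of_set (snd c ` fst c)) (snd c)"
  using smooth_manifold unfolding smooth_manifold_def by blast

lemma chart_openin: "c \<in> atlas M \<Longrightarrow> openin (mtop M) (fst c)"
  using smooth_manifold unfolding smooth_manifold_def by blast

lemma relatively_open_chart_image:
  assumes c: "c \<in> atlas M" and U: "openin (mtop M) U"
  shows "relatively_open V (snd c ` (fst c \<inter> U))"
proof
  have "openin (subtopology (mtop M) (fst c)) (fst c \<inter> U)"
    using U by (simp add: openin_subtopology_Int2)
  then have "openin (top_of_set (snd c ` fst c)) (snd c ` (fst c \<inter> U))"
    using homeomorphic_map_openness_eq[OF chart_homeomorphic[OF c]] by blast
  moreover have "openin (top_of_set V) (snd c ` fst c)"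
    using c smooth_manifold unfolding smooth_manifold_def by blast
  ultimately show "openin (top_of_set V) (snd c ` (fst c \<inter> U))"
    by (rule openin_trans)
qed (rule subspace_model)

lemma relatively_open_chart: "c \<in> atlas M \<Longrightarrow> relatively_open V (snd c ` fst c)"
  using relatively_open_chart_image[OF _ chart_openin, of c c] by simp

lemma relatively_open_overlap:
  "c \<in> atlas M \<Longrightarrow> c' \<in> atlas M \<Longrightarrow> relatively_open V (snd c ` (fst c \<inter> fst c'))"
  using relatively_open_chart_image chart_openin by blast

lemma chart_inv_left: "c \<in> atlas M \<Longrightarrow> p \<in> fst c \<Longrightarrow> chart_inv c (snd c p) = p"
proof -
  assume c: "c \<in> atlas M" "p \<in> fst c"
  have "inj_on (snd c) (fst c)"
    using homeomorphic_imp_injective_map[OF chart_homeomorphic[OF c(1)]] chart_subset[OF c(1)]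
    by (simp add: Int_absorb1)
  then show ?thesis using c by (simp add: chart_inv_def)
qed

lemma chart_in_model: "c \<in> atlas M \<Longrightarrow> p \<in> fst c \<Longrightarrow> snd c p \<in> V"
  using relatively_open.W_subset[OF relatively_open_chart] by blast

lemma transition_smooth:
  "c \<in> atlas M \<Longrightarrow> c' \<in> atlas M \<Longrightarrow> smooth_on V (snd c ` (fst c \<inter> fst c')) (snd c' \<circ> chart_inv c)"
  using smooth_manifold unfolding smooth_manifold_def by blast

lemma transition_into_model:
  "c \<in> atlas M \<Longrightarrow> c' \<in> atlas M \<Longrightarrow> (snd c' \<circ> chart_inv c) ` (snd c ` (fst c \<inter> fst c')) \<subseteq> V"
  by (auto simp: chart_inv_left chart_in_model)

lemma transition_has_derivative:
  assumes "c \<in> atlas M" "c' \<in> atlas M" "p \<in> fst c" "p \<in> fst c'"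
  shows "((snd c' \<circ> chart_inv c) has_derivative transition_deriv M p c c') (at (snd c p) within V)"
  unfolding transition_deriv_def
  by (rule relatively_open.smooth_on_differentiable[OF relatively_open_overlap transition_smooth])
    (use assms in auto)

lemma linear_transition:
  assumes "c \<in> atlas M" "c' \<in> atlas M" "p \<in> fst c" "p \<in> fst c'"
  shows "linear (transition_deriv M p c c')"
  using has_derivative_linear[OF transition_has_derivative[OF assms]] .

lemma transition_in_model:
  assumes "c \<in> atlas M" "c' \<in> atlas M" "p \<in> fst c" "p \<in> fst c'" "w \<in> V"
  shows "transition_deriv M p c c' w \<in> V"
  by (rule relatively_open.has_derivative_into_V[OF relatively_open_overlap[OF assms(1,2)] _
        transition_into_model[OF assms(1,2)] transition_has_derivative[OF assms(1-4)] assms(5)])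
    (use assms in auto)

lemma transition_self:
  assumes "c \<in> atlas M" "p \<in> fst c" "w \<in> V"
  shows "transition_deriv M p c c w = w"
proof -
  interpret relatively_open V "snd c ` fst c" using relatively_open_chart[OF assms(1)] .
  have "((snd c \<circ> chart_inv c) has_derivative (\<lambda>x. x)) (at (snd c p) within V)"
    by (rule has_derivative_cong_on[of _ "\<lambda>x. x"]) (use assms in \<open>auto simp: chart_inv_left\<close>)
  then show ?thesis
    unfolding transition_deriv_def
    using frechet_derivative_eq[OF _ assms(3)] assms(2) by blast
qed

text \<open>The chain rule on the triple overlap, where the direct coordinate change is the
  composite of the other two.\<close>

lemma transition_compose:
  assumes c: "c \<in> atlas M" "c' \<in> atlas M" "c'' \<in> atlas M"
    and p: "p \<in> fst c" "p \<in> fst c'" "p \<in> fst c''" and w: "w \<in> V"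
  shows "transition_deriv M p c' c'' (transition_deriv M p c c' w) = transition_deriv M p c c'' w"
proof -
  let ?W = "snd c ` (fst c \<inter> (fst c' \<inter> fst c''))"
  interpret relatively_open V ?W
    using relatively_open_chart_image[OF c(1)] chart_openin c by blast
  have x: "snd c p \<in> ?W" using p by blast
  have "((\<lambda>x. (snd c'' \<circ> chart_inv c') ((snd c' \<circ> chart_inv c) x)) has_derivative
      (\<lambda>h. transition_deriv M p c' c'' (transition_deriv M p c c' h))) (at (snd c p) within V)"
  proof (rule has_derivative_compose_on[OF x, where \<tau>="snd c' \<circ> chart_inv c" and g="snd c'' \<circ> chart_inv c'"
        and \<tau>'="transition_deriv M p c c'" and g'="transition_deriv M p c' c''"])
    show "(snd c' \<circ> chart_inv c) ` ?W \<subseteq> V" using transition_into_model[OF c(1,2)] by blast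
    show "((snd c' \<circ> chart_inv c) has_derivative transition_deriv M p c c') (at (snd c p) within V)"
      using transition_has_derivative c p by blast
    show "((snd c'' \<circ> chart_inv c') has_derivative transition_deriv M p c' c'')
        (at ((snd c' \<circ> chart_inv c) (snd c p)) within V)"
      using transition_has_derivative[OF c(2,3) p(2,3)] c p by (simp add: chart_inv_left)
  qed
  then have "((snd c'' \<circ> chart_inv c) has_derivative
      (\<lambda>h. transition_deriv M p c' c'' (transition_deriv M p c c' h))) (at (snd c p) within V)"
    by (rule has_derivative_cong_on[OF x, rotated]) (use c in \<open>auto simp: chart_inv_left\<close>)
  then show ?thesis
    unfolding transition_deriv_def[of M p c c''] by (rule frechet_derivative_eq[OF x w, symmetric])
qed

lemma tangent_spaceD:
  assumes "v \<in> tangent_space M p"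
  shows "c \<in> atlas M \<Longrightarrow> p \<in> fst c \<Longrightarrow> v c \<in> V"
    "\<not> (c \<in> atlas M \<and> p \<in> fst c) \<Longrightarrow> v c = 0"
    "c \<in> atlas M \<Longrightarrow> c' \<in> atlas M \<Longrightarrow> p \<in> fst c \<Longrightarrow> p \<in> fst c' \<Longrightarrow>
      v c' = transition_deriv M p c c' (v c)"
  using assms unfolding tangent_space_def by blast+

lemma tangent_space_add:
  assumes "u \<in> tangent_space M p" "v \<in> tangent_space M p"
  shows "tangent_add u r v \<in> tangent_space M p"
  unfolding tangent_space_def mem_Collect_eq
proof (intro conjI allI impI ballI)
  fix c c' assume c: "c \<in> atlas M" "c' \<in> atlas M" and "p \<in> fst c \<and> p \<in> fst c'"
  then have p: "p \<in> fst c" "p \<in> fst c'" by auto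
  show "u c' + r *\<^sub>R v c' = transition_deriv M p c c' (u c + r *\<^sub>R v c)"
    using tangent_spaceD(3)[OF assms(1) c p] tangent_spaceD(3)[OF assms(2) c p] linear_transition[OF c p]
    by (simp add: linear_add linear_cmul)
qed (use assms add_scaled_model in \<open>simp_all add: tangent_spaceD\<close>)

lemma tangent_of_coord_in:
  assumes "c \<in> atlas M" "p \<in> fst c" "w \<in> V"
  shows "tangent_of_coord M c p w \<in> tangent_space M p"
  using assms unfolding tangent_space_def tangent_of_coord_def
  by (auto simp: transition_in_model transition_compose)

lemma tangent_of_coord_coord:
  assumes "c \<in> atlas M" "p \<in> fst c" "v \<in> tangent_space M p"
  shows "tangent_of_coord M c p (v c) = v"
proof
  fix c' show "tangent_of_coord M c p (v c) c' = v c'"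
    using tangent_spaceD(2)[OF assms(3), of c'] tangent_spaceD(3)[OF assms(3,1), of c'] assms(2)
    unfolding tangent_of_coord_def by metis
qed

lemma coord_tangent_of_coord:
  "c' \<in> atlas M \<Longrightarrow> p \<in> fst c' \<Longrightarrow> tangent_of_coord M c p w c' = transition_deriv M p c c' w"
  by (simp add: tangent_of_coord_def)

lemma tangent_of_coord_change:
  assumes "c \<in> atlas M" "c' \<in> atlas M" "p \<in> fst c" "p \<in> fst c'" "w \<in> V"
  shows "tangent_of_coord M c p w = tangent_of_coord M c' p (transition_deriv M p c c' w)"
  using assms by (auto simp: tangent_of_coord_def transition_compose)

lemma tangent_of_coord_add:
  assumes "c \<in> atlas M" "p \<in> fst c"
  shows "tangent_of_coord M c p (u + r *\<^sub>R v)
    = tangent_add (tangent_of_coord M c p u) r (tangent_of_coord M c p v)"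
  using linear_transition[OF assms(1) _ assms(2)]
  by (auto simp: tangent_of_coord_def linear_add linear_cmul)

section \<open>The algebra of differential forms\<close>

lemma form_multilinear:
  "\<omega> \<in> forms_set M \<Longrightarrow> p \<in> points M \<Longrightarrow> multilinear_on tangent_add (tangent_space M p) (\<omega> p)"
  unfolding forms_set_def multilinear_on_def by blast

lemma form_alternating: "\<omega> \<in> forms_set M \<Longrightarrow> alternating_on (tangent_space M p) (\<omega> p)"
  unfolding forms_set_def alternating_on_def by fastforce

lemma form_outside:
  "\<omega> \<in> forms_set M \<Longrightarrow> \<not> (p \<in> points M \<and> set vs \<subseteq> tangent_space M p) \<Longrightarrow> \<omega> p vs = 0"
  unfolding forms_set_def by blast

lemma form_smooth:
  "\<omega> \<in> forms_set M \<Longrightarrow> c \<in> atlas M \<Longrightarrow> set ws \<subseteq> V \<Longrightarrow>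
    smooth_on V (snd c ` fst c) (form_coord M c \<omega> ws)"
  unfolding forms_set_def by blast

text \<open>Vanishing on every list with a repetition is reduced to equal neighbours by
  multilinearity inside the tangent space; lists leaving it are covered by
  \<open>out\<close>.\<close>

lemma forms_setI:
  fixes \<omega> :: "('m, 'a) form"
  assumes out: "\<And>p vs. \<not> (p \<in> points M \<and> set vs \<subseteq> tangent_space M p) \<Longrightarrow> \<omega> p vs = 0"
    and ml: "\<And>p. p \<in> points M \<Longrightarrow> multilinear_on tangent_add (tangent_space M p) (\<omega> p)"
    and alt: "\<And>p. p \<in> points M \<Longrightarrow> alternating_on (tangent_space M p) (\<omega> p)"
    and smooth: "\<And>c ws. c \<in> atlas M \<Longrightarrow> set ws \<subseteq> V \<Longrightarrow>
      smooth_on V (snd c ` fst c) (form_coord M c \<omega> ws)"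
  shows "\<omega> \<in> forms_set M"
  unfolding forms_set_def mem_Collect_eq
proof (intro conjI allI impI ballI)
  fix p and vs :: "('m, 'a) tvec list" assume d: "\<not> distinct vs"
  show "\<omega> p vs = 0"
  proof (cases "p \<in> points M \<and> set vs \<subseteq> tangent_space M p")
    case True
    then show ?thesis
      using alternating_on_not_distinct[OF tangent_space_add ml alt] d by blast
  qed (rule out)
qed (use out ml smooth in \<open>auto simp: multilinear_on_def\<close>)

lemma form_coord_multilinear:
  assumes "\<omega> \<in> forms_set M" "c \<in> atlas M" "x \<in> snd c ` fst c"
  shows "multilinear_on add_scaled V (\<lambda>ws. form_coord M c \<omega> ws x)"
proof -
  have p: "chart_inv c x \<in> fst c" using assms by (auto simp: chart_inv_left)
  then have "multilinear_on tangent_add (tangent_space M (chart_inv c x)) (\<omega> (chart_inv c x))"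
    using form_multilinear[OF assms(1)] chart_subset[OF assms(2)] by blast
  then show ?thesis
    unfolding form_coord_def
    by (rule multilinear_on_map)
      (use assms(2) p in \<open>auto simp: tangent_of_coord_in tangent_of_coord_add\<close>)
qed

lemma form_coord_alternating:
  assumes "\<omega> \<in> forms_set M" "c \<in> atlas M" "x \<in> snd c ` fst c"
  shows "alternating_on V (\<lambda>ws. form_coord M c \<omega> ws x)"
  unfolding form_coord_def
  by (rule alternating_on_map[OF form_alternating[OF assms(1)]])
    (use assms in \<open>auto simp: chart_inv_left tangent_of_coord_in\<close>)

lemma form_coord_at:
  assumes "c \<in> atlas M" "p \<in> fst c" "set vs \<subseteq> tangent_space M p"
  shows "form_coord M c \<omega> (map (\<lambda>v. v c) vs) (snd c p) = \<omega> p vs"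
proof -
  have "map (tangent_of_coord M c p) (map (\<lambda>v. v c) vs) = vs"
    using assms by (auto simp: tangent_of_coord_coord intro!: map_idI)
  then show ?thesis using assms by (simp add: form_coord_def chart_inv_left)
qed

text \<open>The pull-back formula. The derivative applied to the arguments depends on x, and this is
  what calls for the product rule with moving arguments.\<close>

lemma form_coord_change:
  assumes "c \<in> atlas M" "c' \<in> atlas M" "x \<in> snd c ` (fst c \<inter> fst c')" "set ws \<subseteq> V"
  shows "form_coord M c \<omega> ws x = form_coord M c' \<omega>
    (map (frechet_derivative (snd c' \<circ> chart_inv c) (at x within V)) ws) ((snd c' \<circ> chart_inv c) x)"
proof -
  obtain p where p: "x = snd c p" "p \<in> fst c" "p \<in> fst c'" using assms(3) by auto
  have eq: "map (tangent_of_coord M c p) ws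
      = map (tangent_of_coord M c' p) (map (transition_deriv M p c c') ws)"
    using tangent_of_coord_change[OF assms(1,2) p(2,3)] assms(4) by (simp add: subset_iff)
  have "form_coord M c \<omega> ws x = \<omega> p (map (tangent_of_coord M c p) ws)"
    using assms p by (simp add: form_coord_def chart_inv_left)
  also have "\<dots> = form_coord M c' \<omega> (map (transition_deriv M p c c') ws) (snd c' p)"
    unfolding eq using assms p by (simp add: form_coord_def chart_inv_left)
  finally show ?thesis
    using assms p by (simp add: chart_inv_left transition_deriv_def)
qed

lemma ext_deriv_coord_altsum:
  "ext_deriv_coord M c \<omega> ws x = altsum (\<lambda>u us. frechet_derivative (form_coord M c \<omega> us) (at x within V) u) ws"
  by (simp add: ext_deriv_coord_def altsum_def)

text \<open>
  Pulling back along a coordinate change produces second derivatives of the coordinate change; these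
  are symmetric, so they cancel in the alternating sum.
\<close>

lemma ext_deriv_coord_change:
  assumes \<omega>: "\<omega> \<in> forms_set M" and c: "c \<in> atlas M" "c' \<in> atlas M"
    and p: "p \<in> fst c" "p \<in> fst c'" and ws: "set ws \<subseteq> V"
  shows "ext_deriv_coord M c \<omega> ws (snd c p)
    = ext_deriv_coord M c' \<omega> (map (transition_deriv M p c c') ws) (snd c' p)"
proof -
  let ?W = "snd c ` (fst c \<inter> fst c')"
  interpret relatively_open V ?W using relatively_open_overlap[OF c] .
  interpret W': relatively_open V "snd c' ` fst c'" using relatively_open_chart[OF c(2)] .
  define \<tau> where "\<tau> = snd c' \<circ> chart_inv c"
  define x where "x = snd c p"
  have x: "x \<in> ?W" using p by (auto simp: x_def)
  have \<tau>x: "\<tau> x = snd c' p" using c p by (simp add: \<tau>_def x_def chart_inv_left)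
  have \<tau>W: "\<tau> ` ?W \<subseteq> V" "\<tau> ` ?W \<subseteq> snd c' ` fst c'"
    using transition_into_model[OF c] c by (auto simp: \<tau>_def chart_inv_left)
  define T where "T y = frechet_derivative \<tau> (at y within V)" for y
  have smooth: "smooth_on V ?W \<tau>" using transition_smooth[OF c] by (simp add: \<tau>_def)
  have T: "(\<tau> has_derivative T y) (at y within V)" if "y \<in> ?W" for y
    unfolding T_def using smooth_on_differentiable[OF smooth that] .
  have Tx: "T x = transition_deriv M p c c'"
    by (simp add: T_def x_def transition_deriv_def \<tau>_def)
  \<comment> \<open>The second derivative of the coordinate change at x: \<open>T y w\<close>
    differentiated in y along u.\<close>
  define B where "B u w = frechet_derivative (\<lambda>y. T y w) (at x within V) u" for u w
  have B: "((\<lambda>y. T y w) has_derivative (\<lambda>u. B u w)) (at x within V)" if "w \<in> V" for w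
    unfolding B_def T_def using smooth_on_differentiable[OF smooth_on_derivative[OF smooth that] x] .
  have sym: "B u w = B w u" if "u \<in> V" "w \<in> V" for u w
    unfolding B_def T_def
    by (rule second_derivative_symmetric[OF _ x that(2,1)]) (use smooth in \<open>auto simp: smooth_on_def\<close>)
  have TV: "T y w \<in> V" if "y \<in> ?W" "w \<in> V" for y w
    using has_derivative_into_V[OF that(1) \<tau>W(1) T[OF that(1)] that(2)] .
  have BV: "B u w \<in> V" if "u \<in> V" "w \<in> V" for u w
    using has_derivative_into_V[OF x _ B[OF that(2)] that(1)] TV that by blast
  \<comment> \<open>Only the base point is transported here; inserting the vectors
    \<open>T y w\<close> as arguments turns \<open>H\<close> into the coefficient in the chart
    c.\<close>
  define H where "H us y = form_coord M c' \<omega> us (\<tau> y)" for us y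
  have H_ml: "multilinear_on add_scaled V (\<lambda>us. H us y)" if "y \<in> ?W" for y
    unfolding H_def using form_coord_multilinear[OF \<omega> c(2)] \<tau>W(2) that by blast
  have H_alt: "alternating_on V (\<lambda>us. H us x)"
    unfolding H_def using form_coord_alternating[OF \<omega> c(2)] \<tau>W(2) x by blast
  define D where "D us h = frechet_derivative (form_coord M c' \<omega> us) (at (\<tau> x) within V) (T x h)" for us h
  have D: "(H us has_derivative D us) (at x within V)" if "set us \<subseteq> V" for us
  proof -
    have "\<tau> x \<in> snd c' ` fst c'" using \<tau>W(2) x by blast
    from has_derivative_compose_on[OF x \<tau>W(1) T[OF x]
        W'.smooth_on_differentiable[OF form_smooth[OF \<omega> c(2) that] this]]
    show ?thesis unfolding H_def D_def .
  qed
  have deriv: "frechet_derivative (form_coord M c \<omega> us) (at x within V) u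
      = D (map (T x) us) u + subst_sum (\<lambda>us. H us x) (map (\<lambda>w. (T x w, B u w)) us)"
    if u: "u \<in> V" and us: "set us \<subseteq> V" for u us
  proof -
    \<comment> \<open>Each fixed argument w becomes the moving vector \<open>T y w\<close>, paired
      with its derivative in y.\<close>
    let ?ps = "map (\<lambda>w. (\<lambda>y. T y w, \<lambda>u. B u w)) us"
    have ps: "fst p ` ?W \<subseteq> V" "(fst p has_derivative snd p) (at x within V)" if "p \<in> set ?ps" for p
      using that us TV B by auto
    obtain D' where D': "((\<lambda>y. H (map (\<lambda>p. fst p y) ?ps) y) has_derivative D') (at x within V)"
      "\<forall>h\<in>V. D' h = D (map (\<lambda>p. fst p x) ?ps) h
        + subst_sum (\<lambda>ws. H ws x) (map (\<lambda>p. (fst p x, snd p h)) ?ps)"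
      using has_derivative_multilinear[OF x H_ml D ps] by blast
    have "H (map (\<lambda>p. fst p y) ?ps) y = form_coord M c \<omega> us y" if "y \<in> ?W" for y
      using form_coord_change[OF c that us] by (simp add: H_def T_def \<tau>_def comp_def)
    from has_derivative_cong_on[OF x this D'(1)]
    have "frechet_derivative (form_coord M c \<omega> us) (at x within V) u = D' u"
      using frechet_derivative_eq[OF x u] by blast
    then show ?thesis using D'(2) u by (simp add: comp_def)
  qed
  have "ext_deriv_coord M c \<omega> ws x
      = altsum (\<lambda>u us. D (map (T x) us) u + subst_sum (\<lambda>us. H us x) (map (\<lambda>w. (T x w, B u w)) us)) ws"
    unfolding ext_deriv_coord_altsum by (rule altsum_cong[OF ws deriv])
  also have "\<dots> = altsum (\<lambda>u us. D (map (T x) us) u) ws"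
  proof -
    have "altsum (\<lambda>u us. subst_sum (\<lambda>us. H us x) (map (\<lambda>w. (T x w, B u w)) us)) ws = 0"
      by (rule altsum_subst_sum_symmetric[OF add_scaled_model H_ml[OF x] H_alt])
        (use TV[OF x] BV sym ws in blast)+
    then show ?thesis by (simp add: altsum_add)
  qed
  also have "\<dots> = ext_deriv_coord M c' \<omega> (map (T x) ws) (\<tau> x)"
    by (simp add: ext_deriv_coord_altsum altsum_map D_def)
  finally show ?thesis by (simp add: x_def[symmetric] Tx \<tau>x)
qed

section \<open>The exterior differential is an odd derivation\<close>

lemma coords_in_model:
  assumes "c \<in> atlas M" "p \<in> fst c" "set vs \<subseteq> tangent_space M p"
  shows "set (map (\<lambda>v. v c) vs) \<subseteq> V"
proof -
  have "v c \<in> V" if "v \<in> set vs" for v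
    using tangent_spaceD(1)[OF _ assms(1,2)] assms(3) that by blast
  then show ?thesis by auto
qed

text \<open>The coordinates of the vectors in c are the images of their coordinates in the chosen
  chart, so \<open>ext_deriv_coord_change\<close> exchanges the charts. From here on one chart can
  be fixed around p.\<close>

lemma ext_deriv_eq:
  assumes \<omega>: "\<omega> \<in> forms_set M" and c: "c \<in> atlas M" "p \<in> fst c" and vs: "set vs \<subseteq> tangent_space M p"
  shows "ext_deriv M \<omega> p vs = ext_deriv_coord M c \<omega> (map (\<lambda>v. v c) vs) (snd c p)"
proof -
  let ?c = "chart_at M p"
  have p: "p \<in> points M" using c chart_subset by blast
  note cp = chart_at[OF p]
  have coords: "map (\<lambda>v. v c) vs = map (transition_deriv M p ?c c) (map (\<lambda>v. v ?c) vs)"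
    using tangent_spaceD(3)[OF _ _ c(1) _ c(2), of _ ?c] cp vs by auto
  have "set (map (\<lambda>v. v ?c) vs) \<subseteq> V"
    using coords_in_model[OF _ _ vs] cp by blast
  then have "ext_deriv_coord M ?c \<omega> (map (\<lambda>v. v ?c) vs) (snd ?c p)
      = ext_deriv_coord M c \<omega> (map (\<lambda>v. v c) vs) (snd c p)"
    unfolding coords using cp by (intro ext_deriv_coord_change[OF \<omega> _ c(1) _ c(2)]) auto
  then show ?thesis using \<omega> p vs by (simp add: ext_deriv_def Forms_def Let_def)
qed

lemma ext_deriv_outside:
  "\<omega> \<in> forms_set M \<Longrightarrow> \<not> (p \<in> points M \<and> set vs \<subseteq> tangent_space M p) \<Longrightarrow> ext_deriv M \<omega> p vs = 0"
  by (auto simp: ext_deriv_def Forms_def)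

lemma ext_deriv_coord_multilinear:
  assumes \<omega>: "\<omega> \<in> forms_set M" and c: "c \<in> atlas M" and x: "x \<in> snd c ` fst c"
  shows "multilinear_on add_scaled V (\<lambda>ws. ext_deriv_coord M c \<omega> ws x)"
  unfolding ext_deriv_coord_altsum
proof (rule altsum_multilinear)
  interpret relatively_open V "snd c ` fst c" using relatively_open_chart[OF c] .
  have D: "(form_coord M c \<omega> us has_derivative frechet_derivative (form_coord M c \<omega> us) (at x within V))
      (at x within V)" if "set us \<subseteq> V" for us
    using smooth_on_differentiable[OF form_smooth[OF \<omega> c that] x] .
  show "multilinear_on add_scaled V (\<lambda>us. frechet_derivative (form_coord M c \<omega> us) (at x within V) u)"
    if "u \<in> V" for u
    using multilinear_on_derivative[OF x that form_coord_multilinear[OF \<omega> c] D] by simp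
  show "frechet_derivative (form_coord M c \<omega> us) (at x within V) (u + r *\<^sub>R v)
      = frechet_derivative (form_coord M c \<omega> us) (at x within V) u
        + r * frechet_derivative (form_coord M c \<omega> us) (at x within V) v"
    if "set us \<subseteq> V" for u v r us
    using has_derivative_linear[OF D[OF that]] by (simp add: linear_add linear_cmul)
qed (rule add_scaled_model)

text \<open>A coefficient with equal neighbouring arguments is zero on the whole chart image, so its
  derivative is zero too, and the alternating sum inherits alternation.\<close>

lemma ext_deriv_coord_alternating:
  assumes \<omega>: "\<omega> \<in> forms_set M" and c: "c \<in> atlas M" and x: "x \<in> snd c ` fst c"
  shows "alternating_on V (\<lambda>ws. ext_deriv_coord M c \<omega> ws x)"
  unfolding ext_deriv_coord_altsum
proof (rule altsum_alternating)
  interpret relatively_open V "snd c ` fst c" using relatively_open_chart[OF c] .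
  fix u assume u: "u \<in> V"
  show "alternating_on V (\<lambda>us. frechet_derivative (form_coord M c \<omega> us) (at x within V) u)"
    unfolding alternating_on_def
  proof (intro allI impI)
    fix us ws w assume s: "set us \<union> set ws \<union> {w} \<subseteq> V"
    have "form_coord M c \<omega> (us @ w # w # ws) y = 0" if "y \<in> snd c ` fst c" for y
      using alternating_onD[OF form_coord_alternating[OF \<omega> c that]] s by auto
    then have "frechet_derivative (form_coord M c \<omega> (us @ w # w # ws)) (at x within V)
        = frechet_derivative (\<lambda>_. 0) (at x within V)"
      by (intro frechet_derivative_cong_on[OF x]) auto
    moreover have "frechet_derivative (\<lambda>_. 0::real) (at x within V) u = 0"
      by (rule frechet_derivative_eq[OF x u]) simp
    ultimately show "frechet_derivative (form_coord M c \<omega> (us @ w # w # ws)) (at x within V) u = 0" by simp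
  qed
qed

lemma ext_deriv_form:
  assumes \<omega>: "\<omega> \<in> forms_set M"
  shows "ext_deriv M \<omega> \<in> forms_set M"
proof (rule forms_setI)
  fix p assume p: "p \<in> points M"
  let ?c = "chart_at M p"
  have c: "?c \<in> atlas M" "p \<in> fst ?c" using chart_at[OF p] by auto
  then have x: "snd ?c p \<in> snd ?c ` fst ?c" by blast
  have eq: "ext_deriv_coord M ?c \<omega> (map (\<lambda>v. v ?c) vs) (snd ?c p) = ext_deriv M \<omega> p vs"
    if "set vs \<subseteq> tangent_space M p" for vs
    using ext_deriv_eq[OF \<omega> c that] by simp
  have V: "(\<lambda>v. v ?c) ` tangent_space M p \<subseteq> V" using tangent_spaceD(1) c by blast
  show "multilinear_on tangent_add (tangent_space M p) (ext_deriv M \<omega> p)"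
    by (rule multilinear_on_cong[OF tangent_space_add eq])
      (auto intro: multilinear_on_map[OF ext_deriv_coord_multilinear[OF \<omega> c(1) x] V])
  show "alternating_on (tangent_space M p) (ext_deriv M \<omega> p)"
    by (rule alternating_on_cong[OF eq])
      (auto intro: alternating_on_map[OF ext_deriv_coord_alternating[OF \<omega> c(1) x] V])
next
  fix c and ws :: "'a list" assume c: "c \<in> atlas M" and ws: "set ws \<subseteq> V"
  interpret relatively_open V "snd c ` fst c" using relatively_open_chart[OF c] .
  \<comment> \<open>Chart independence allows the same c at all points of its domain, so the
    coefficient of d\<omega> is a finite sum of derivatives of smooth functions.\<close>
  have "ext_deriv_coord M c \<omega> ws x = form_coord M c (ext_deriv M \<omega>) ws x" if x: "x \<in> snd c ` fst c" for x
  proof -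
    obtain p where p: "x = snd c p" "p \<in> fst c" using x by auto
    have T: "set (map (tangent_of_coord M c p) ws) \<subseteq> tangent_space M p"
      using tangent_of_coord_in[OF c p(2)] ws by auto
    have "map (\<lambda>v. v c) (map (tangent_of_coord M c p) ws) = ws"
      using coord_tangent_of_coord[OF c p(2), of c] transition_self[OF c p(2)] ws
      by (simp add: subset_iff map_idI)
    then show ?thesis
      using ext_deriv_eq[OF \<omega> c p(2) T] p c by (simp add: form_coord_def chart_inv_left)
  qed
  moreover have "smooth_on V (snd c ` fst c) (ext_deriv_coord M c \<omega> ws)"
  proof -
    have "smooth_on V (snd c ` fst c) (\<lambda>x. \<Sum>i<length ws. (-1) ^ i *
        frechet_derivative (form_coord M c \<omega> (take i ws @ drop (Suc i) ws)) (at x within V) (ws ! i))"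
    proof (intro smooth_on_sum smooth_on_mult smooth_on_const smooth_on_derivative form_smooth[OF \<omega> c])
      fix i assume "i \<in> {..<length ws}"
      then show "ws ! i \<in> V" using ws by auto
      show "set (take i ws @ drop (Suc i) ws) \<subseteq> V"
        using ws set_take_subset[of i ws] set_drop_subset[of "Suc i" ws] by auto
    qed
    then show ?thesis unfolding ext_deriv_coord_def .
  qed
  ultimately show "smooth_on V (snd c ` fst c) (form_coord M c (ext_deriv M \<omega>) ws)"
    using smooth_on_cong by blast
qed (rule ext_deriv_outside[OF \<omega>])

section \<open>Closure of forms under wedge products and linear combinations\<close>

lemma form_coord_wedge:
  "form_coord M c (wedge \<alpha> \<beta>) ws x
    = shuffle_prod (\<lambda>us. form_coord M c \<alpha> us x) (\<lambda>us. form_coord M c \<beta> us x) ws"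
  by (simp add: form_coord_def wedge_shuffle_prod shuffle_prod_map)

lemma wedge_form:
  assumes \<alpha>: "\<alpha> \<in> forms_set M" and \<beta>: "\<beta> \<in> forms_set M"
  shows "wedge \<alpha> \<beta> \<in> forms_set M"
proof (rule forms_setI)
  show "wedge \<alpha> \<beta> p vs = 0" if "\<not> (p \<in> points M \<and> set vs \<subseteq> tangent_space M p)" for p vs
  proof (cases "p \<in> points M")
    case True
    then show ?thesis
      unfolding wedge_shuffle_prod using that form_outside[OF \<alpha>] form_outside[OF \<beta>]
      by (intro shuffle_prod_outside[of "tangent_space M p"]) auto
  qed (simp add: wedge_def form_outside[OF \<alpha>])
  show "multilinear_on tangent_add (tangent_space M p) (wedge \<alpha> \<beta> p)" if "p \<in> points M" for p
    unfolding wedge_shuffle_prod using that \<alpha> \<beta> by (intro shuffle_prod_multilinear form_multilinear)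
  show "alternating_on (tangent_space M p) (wedge \<alpha> \<beta> p)" for p
    unfolding wedge_shuffle_prod using \<alpha> \<beta> by (intro shuffle_prod_alternating form_alternating)
next
  fix c and ws :: "'a list" assume c: "c \<in> atlas M" and ws: "set ws \<subseteq> V"
  interpret relatively_open V "snd c ` fst c" using relatively_open_chart[OF c] .
  have "set (nths ws I) \<subseteq> V" for I using ws set_nths_subset[of ws I] by blast
  then have "smooth_on V (snd c ` fst c) (\<lambda>x. \<Sum>I\<in>Pow {..<length ws}. (-1) ^ card (inversions I)
      * form_coord M c \<alpha> (nths ws I) x * form_coord M c \<beta> (nths ws (- I)) x)"
    by (intro smooth_on_sum smooth_on_mult smooth_on_const form_smooth \<alpha> \<beta> c)
  then show "smooth_on V (snd c ` fst c) (form_coord M c (wedge \<alpha> \<beta>) ws)"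
    by (rule smooth_on_cong) (simp add: form_coord_wedge shuffle_prod_def)
qed

text \<open>One lemma for sums, multiples by functions and real multiples: f is taken constant on M,
  or \<alpha> is taken zero.\<close>

lemma lincomb_form:
  assumes \<alpha>: "\<alpha> \<in> forms_set M" and \<beta>: "\<beta> \<in> forms_set M" and f: "f \<in> carrier (Cinf M)"
  shows "(\<lambda>p vs. \<alpha> p vs + f p * \<beta> p vs) \<in> forms_set M"
proof (rule forms_setI)
  show "multilinear_on tangent_add (tangent_space M p) (\<lambda>vs. \<alpha> p vs + f p * \<beta> p vs)"
    if "p \<in> points M" for p
    using form_multilinear[OF \<alpha> that] form_multilinear[OF \<beta> that]
    by (simp add: multilinear_on_def algebra_simps)
  show "alternating_on (tangent_space M p) (\<lambda>vs. \<alpha> p vs + f p * \<beta> p vs)" for p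
    using form_alternating[OF \<alpha>, of p] form_alternating[OF \<beta>, of p] by (simp add: alternating_on_def)
next
  fix c and ws :: "'a list" assume c: "c \<in> atlas M" and ws: "set ws \<subseteq> V"
  interpret relatively_open V "snd c ` fst c" using relatively_open_chart[OF c] .
  have "smooth_on V (snd c ` (fst c \<inter> points M)) (f \<circ> chart_inv c)"
    using f c by (simp add: Cinf_def manifold_smooth_on_def)
  then have "smooth_on V (snd c ` fst c) (f \<circ> chart_inv c)"
    using chart_subset[OF c] by (simp only: Int_absorb2)
  then have "smooth_on V (snd c ` fst c)
      (\<lambda>x. form_coord M c \<alpha> ws x + (f \<circ> chart_inv c) x * form_coord M c \<beta> ws x)"
    by (intro smooth_on_add smooth_on_mult form_smooth \<alpha> \<beta> c ws)
  then show "smooth_on V (snd c ` fst c) (form_coord M c (\<lambda>p vs. \<alpha> p vs + f p * \<beta> p vs) ws)"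
    by (rule smooth_on_cong) (simp add: form_coord_def)
qed (use form_outside[OF \<alpha>] form_outside[OF \<beta>] in auto)

lemma zero_form: "(\<lambda>p vs. 0) \<in> forms_set M"
proof (rule forms_setI)
  fix c and ws :: "'a list" assume "c \<in> atlas M"
  then show "smooth_on V (snd c ` fst c) (form_coord M c (\<lambda>p vs. 0) ws)"
    unfolding form_coord_def by (rule relatively_open.smooth_on_const[OF relatively_open_chart])
qed (simp_all add: multilinear_on_def alternating_on_def)

lemma const_in_Cinf: "(\<lambda>p. if p \<in> points M then r else 0) \<in> carrier (Cinf M)"
proof -
  have "smooth_on V (snd c ` (fst c \<inter> points M)) ((\<lambda>p. if p \<in> points M then r else 0) \<circ> chart_inv c)"
    if c: "c \<in> atlas M" for c
  proof -
    interpret relatively_open V "snd c ` (fst c \<inter> points M)"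
      using relatively_open_chart_image[OF c] by blast
    show ?thesis
      by (rule smooth_on_cong[OF smooth_on_const[of r]]) (use c in \<open>auto simp: chart_inv_left\<close>)
  qed
  then show ?thesis by (simp add: Cinf_def manifold_smooth_on_def)
qed

lemma add_form: "\<alpha> \<in> forms_set M \<Longrightarrow> \<beta> \<in> forms_set M \<Longrightarrow> (\<lambda>p vs. \<alpha> p vs + \<beta> p vs) \<in> forms_set M"
proof -
  assume \<alpha>: "\<alpha> \<in> forms_set M" and \<beta>: "\<beta> \<in> forms_set M"
  have "(\<lambda>p vs. \<alpha> p vs + \<beta> p vs) = (\<lambda>p vs. \<alpha> p vs + (if p \<in> points M then 1 else 0) * \<beta> p vs)"
    using form_outside[OF \<beta>] by (auto simp: fun_eq_iff)
  then show ?thesis using lincomb_form[OF \<alpha> \<beta> const_in_Cinf[of 1]] by simp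
qed

lemma smult_form: "f \<in> carrier (Cinf M) \<Longrightarrow> \<alpha> \<in> forms_set M \<Longrightarrow> (\<lambda>p vs. f p * \<alpha> p vs) \<in> forms_set M"
  using lincomb_form[OF zero_form, of \<alpha> f] by simp

lemma form_scale_form: "\<alpha> \<in> forms_set M \<Longrightarrow> form_scale r \<alpha> \<in> forms_set M"
proof -
  assume \<alpha>: "\<alpha> \<in> forms_set M"
  have "form_scale r \<alpha> = (\<lambda>p vs. (if p \<in> points M then r else 0) * \<alpha> p vs)"
    using form_outside[OF \<alpha>] by (auto simp: fun_eq_iff form_scale_def)
  then show ?thesis using smult_form[OF const_in_Cinf \<alpha>] by simp
qed

lemma form_eqI:
  assumes "\<alpha> \<in> forms_set M" "\<beta> \<in> forms_set M"
    and "\<And>p c vs. c \<in> atlas M \<Longrightarrow> p \<in> fst c \<Longrightarrow> set vs \<subseteq> tangent_space M p \<Longrightarrow> \<alpha> p vs = \<beta> p vs"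
  shows "\<alpha> = \<beta>"
proof (intro ext)
  fix p vs show "\<alpha> p vs = \<beta> p vs"
    using assms(3)[of "chart_at M p" p vs] chart_at[of p] form_outside[OF assms(1)] form_outside[OF assms(2)]
    by (cases "p \<in> points M \<and> set vs \<subseteq> tangent_space M p") auto
qed

section \<open>Linearity, Leibniz rule and parity of d\<close>

text \<open>The combination is a separate form \<gamma> given by its values, so that sums fit with
  coefficients 1, 1 and \<open>form_scale\<close> with r, 0.\<close>

lemma ext_deriv_lincomb:
  assumes \<alpha>: "\<alpha> \<in> forms_set M" and \<beta>: "\<beta> \<in> forms_set M"
    and \<gamma>: "\<gamma> \<in> forms_set M" "\<And>p vs. \<gamma> p vs = a * \<alpha> p vs + b * \<beta> p vs"
    and c: "c \<in> atlas M" "p \<in> fst c" and vs: "set vs \<subseteq> tangent_space M p"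
  shows "ext_deriv M \<gamma> p vs = a * ext_deriv M \<alpha> p vs + b * ext_deriv M \<beta> p vs"
proof -
  interpret relatively_open V "snd c ` fst c" using relatively_open_chart[OF c(1)] .
  have x: "snd c p \<in> snd c ` fst c" using c by blast
  have ws: "set (map (\<lambda>v. v c) vs) \<subseteq> V" using coords_in_model[OF c vs] .
  note D = smooth_on_differentiable[OF form_smooth[OF _ c(1)] x]
  have "frechet_derivative (form_coord M c \<gamma> us) (at (snd c p) within V) u
    = a * frechet_derivative (form_coord M c \<alpha> us) (at (snd c p) within V) u
    + b * frechet_derivative (form_coord M c \<beta> us) (at (snd c p) within V) u"
    if "u \<in> V" "set us \<subseteq> V" for u us
  proof (rule frechet_derivative_eq[OF x that(1)])
    have "form_coord M c \<gamma> us = (\<lambda>x. a * form_coord M c \<alpha> us x + b * form_coord M c \<beta> us x)"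
      by (rule ext) (simp add: form_coord_def \<gamma>(2))
    then show "(form_coord M c \<gamma> us has_derivative
      (\<lambda>u. a * frechet_derivative (form_coord M c \<alpha> us) (at (snd c p) within V) u
        + b * frechet_derivative (form_coord M c \<beta> us) (at (snd c p) within V) u)) (at (snd c p) within V)"
      using D[OF \<alpha> that(2)] D[OF \<beta> that(2)]
      by (auto intro!: has_derivative_add has_derivative_mult_right)
  qed
  then have "ext_deriv_coord M c \<gamma> (map (\<lambda>v. v c) vs) (snd c p)
      = a * ext_deriv_coord M c \<alpha> (map (\<lambda>v. v c) vs) (snd c p)
      + b * ext_deriv_coord M c \<beta> (map (\<lambda>v. v c) vs) (snd c p)"
    unfolding ext_deriv_coord_altsum altsum_cmult[symmetric] altsum_add[symmetric]
    by (intro altsum_cong[OF ws]) auto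
  then show ?thesis by (simp add: ext_deriv_eq[OF _ c vs] \<alpha> \<beta> \<gamma>(1))
qed

text \<open>In a fixed chart a coefficient of the wedge product is a finite sum of products, and the
  product rule for functions gives the left side of \<open>altsum_shuffle_prod\<close>. As \<alpha>
  need not be homogeneous, the sign stays inside the first factor.\<close>

lemma ext_deriv_wedge:
  assumes \<alpha>: "\<alpha> \<in> forms_set M" and \<beta>: "\<beta> \<in> forms_set M"
    and c: "c \<in> atlas M" "p \<in> fst c" and vs: "set vs \<subseteq> tangent_space M p"
  shows "ext_deriv M (wedge \<alpha> \<beta>) p vs = shuffle_prod (ext_deriv M \<alpha> p) (\<beta> p) vs
    + shuffle_prod (\<lambda>us. (-1) ^ length us * \<alpha> p us) (ext_deriv M \<beta> p) vs"
proof -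
  interpret relatively_open V "snd c ` fst c" using relatively_open_chart[OF c(1)] .
  have x: "snd c p \<in> snd c ` fst c" using c by blast
  define x where "x = snd c p"
  define ws where "ws = map (\<lambda>v. v c) vs"
  have ws: "set ws \<subseteq> V" using coords_in_model[OF c vs] by (simp add: ws_def)
  define a where "a us = form_coord M c \<alpha> us x" for us
  define b where "b us = form_coord M c \<beta> us x" for us
  define a' where "a' u us = frechet_derivative (form_coord M c \<alpha> us) (at x within V) u" for u us
  define b' where "b' u us = frechet_derivative (form_coord M c \<beta> us) (at x within V) u" for u us
  note D = smooth_on_differentiable[OF form_smooth[OF _ c(1)] x, folded x_def]
  have "frechet_derivative (form_coord M c (wedge \<alpha> \<beta>) us) (at x within V) u
    = shuffle_prod (a' u) b us + shuffle_prod a (b' u) us"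
    if u: "u \<in> V" and us: "set us \<subseteq> V" for u us
  proof -
    have nths: "set (nths us I) \<subseteq> V" for I using us set_nths_subset[of us I] by blast
    let ?s = "\<lambda>I. (-1) ^ card (inversions I) :: real"
    have "form_coord M c (wedge \<alpha> \<beta>) us = (\<lambda>x. \<Sum>I\<in>Pow {..<length us}.
        ?s I * (form_coord M c \<alpha> (nths us I) x * form_coord M c \<beta> (nths us (- I)) x))"
      by (simp add: form_coord_wedge shuffle_prod_def fun_eq_iff mult.assoc)
    moreover have "((\<lambda>x. \<Sum>I\<in>Pow {..<length us}.
        ?s I * (form_coord M c \<alpha> (nths us I) x * form_coord M c \<beta> (nths us (- I)) x))
      has_derivative (\<lambda>h. \<Sum>I\<in>Pow {..<length us}.
        ?s I * (a (nths us I) * b' h (nths us (- I)) + a' h (nths us I) * b (nths us (- I)))))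
      (at x within V)"
      unfolding a_def b_def a'_def b'_def
      by (intro has_derivative_sum has_derivative_mult_right has_derivative_mult D \<alpha> \<beta> nths)
    ultimately have "frechet_derivative (form_coord M c (wedge \<alpha> \<beta>) us) (at x within V) u
      = (\<Sum>I\<in>Pow {..<length us}.
        ?s I * (a (nths us I) * b' u (nths us (- I)) + a' u (nths us I) * b (nths us (- I))))"
      using frechet_derivative_eq[OF x u] by (simp add: x_def)
    also have "\<dots> = shuffle_prod (a' u) b us + shuffle_prod a (b' u) us"
      by (simp add: shuffle_prod_def algebra_simps flip: sum.distrib)
    finally show ?thesis .
  qed
  then have "ext_deriv_coord M c (wedge \<alpha> \<beta>) ws x
      = altsum (\<lambda>u us. shuffle_prod (a' u) b us + shuffle_prod a (b' u) us) ws"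
    unfolding ext_deriv_coord_altsum by (intro altsum_cong[OF ws])
  also have "\<dots> = shuffle_prod (altsum a') b ws
      + shuffle_prod (\<lambda>us. (-1) ^ length us * a us) (altsum b') ws"
    by (rule altsum_shuffle_prod)
  also have "shuffle_prod (altsum a') b ws = shuffle_prod (ext_deriv M \<alpha> p) (\<beta> p) vs"
    unfolding ws_def shuffle_prod_map
    by (rule shuffle_prod_cong)
      (use vs in \<open>auto simp: ext_deriv_eq[OF \<alpha> c] ext_deriv_coord_altsum a'_def[abs_def] b_def x_def form_coord_at[OF c]\<close>)
  also have "shuffle_prod (\<lambda>us. (-1) ^ length us * a us) (altsum b') ws
      = shuffle_prod (\<lambda>us. (-1) ^ length us * \<alpha> p us) (ext_deriv M \<beta> p) vs"
    unfolding ws_def shuffle_prod_map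
    by (rule shuffle_prod_cong)
      (use vs in \<open>auto simp: ext_deriv_eq[OF \<beta> c] ext_deriv_coord_altsum b'_def[abs_def] a_def x_def form_coord_at[OF c]\<close>)
  finally show ?thesis
    using ext_deriv_eq[OF wedge_form[OF \<alpha> \<beta>] c vs] by (simp add: ws_def x_def)
qed

lemma of_nat_bit_eq: "(of_nat n :: bit) = of_bool (odd n)"
  by (induction n) auto

text \<open>On lists of the wrong parity \<alpha> vanishes. This turns the twist of the general
  Leibniz rule into the sign of a homogeneous form.\<close>

lemma form_parity:
  assumes "\<alpha> \<in> Forms_part M j"
  shows "(-1) ^ length vs * \<alpha> p vs = sign j * \<alpha> p vs"
proof (cases "of_nat (length vs) = j")
  case True
  then show ?thesis by (cases "odd (length vs)") (auto simp: sign_def of_nat_bit_eq)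
next
  case False
  then show ?thesis using assms by (simp add: Forms_part_def)
qed

lemma ext_deriv_Forms_part:
  assumes "\<alpha> \<in> Forms_part M j"
  shows "ext_deriv M \<alpha> \<in> Forms_part M (1 + j)"
proof -
  have \<alpha>: "\<alpha> \<in> forms_set M" using assms by (simp add: Forms_part_def Forms_def)
  have "ext_deriv M \<alpha> p vs = 0" if l: "of_nat (length vs) \<noteq> 1 + j" for p vs
  proof (cases "p \<in> points M \<and> set vs \<subseteq> tangent_space M p")
    case True
    have z: "form_coord M c \<alpha> us = (\<lambda>x. 0)" if "Suc (length us) = length vs" for c us
    proof -
      have "of_nat (length us) \<noteq> j" using l that[symmetric] by auto
      then show ?thesis using assms by (simp add: form_coord_def Forms_part_def fun_eq_iff)
    qed
    \<comment> \<open>Even for the zero function the chosen derivative is determined only on V, so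
      the point and the direction have to be placed there.\<close>
    have "frechet_derivative (\<lambda>x::'a. 0::real) (at x within V) v = 0" if "x \<in> V" "v \<in> V" for x v
      using relatively_open.frechet_derivative_eq[of V V x v "\<lambda>x. 0::real" "\<lambda>x. 0"] that subspace_model
      by (simp add: relatively_open_def)
    moreover have "v (chart_at M p) \<in> V" if "v \<in> set vs" for v
      using True chart_at[of p] tangent_spaceD(1) that by blast
    moreover have "snd (chart_at M p) p \<in> V"
      using True chart_at[of p] chart_in_model by blast
    ultimately show ?thesis
      using True \<alpha> by (auto simp: ext_deriv_def Forms_def Let_def ext_deriv_coord_def z intro!: sum.neutral)
  qed (rule ext_deriv_outside[OF \<alpha>])
  then show ?thesis using ext_deriv_form[OF \<alpha>] by (simp add: Forms_part_def Forms_def)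
qed

lemma ext_deriv_in_Der_part: "ext_deriv M \<in> Der_part M 1"
proof -
  have carr: "carrier (Forms M) = forms_set M" by (simp add: Forms_def)
  have "ext_deriv M \<in> forms_set M \<rightarrow>\<^sub>E forms_set M"
    using ext_deriv_form by (auto simp: ext_deriv_def Forms_def)
  moreover have "ext_deriv M (\<lambda>p vs. \<alpha> p vs + \<beta> p vs) = (\<lambda>p vs. ext_deriv M \<alpha> p vs + ext_deriv M \<beta> p vs)"
    if "\<alpha> \<in> forms_set M" "\<beta> \<in> forms_set M" for \<alpha> \<beta>
    using that ext_deriv_lincomb[OF that add_form[OF that], of 1 1]
    by (intro form_eqI ext_deriv_form add_form) auto
  moreover have "ext_deriv M (form_scale r \<alpha>) = form_scale r (ext_deriv M \<alpha>)"
    if "\<alpha> \<in> forms_set M" for r \<alpha>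
    using that ext_deriv_lincomb[OF that that form_scale_form[OF that], of r r 0]
    by (intro form_eqI ext_deriv_form form_scale_form) (auto simp: form_scale_def)
  moreover have "ext_deriv M (wedge \<alpha> \<beta>) = (\<lambda>p vs. wedge (ext_deriv M \<alpha>) \<beta> p vs
      + form_scale (sign (j * 1)) (wedge \<alpha> (ext_deriv M \<beta>)) p vs)"
    if "\<alpha> \<in> Forms_part M j" "\<beta> \<in> forms_set M" for j \<alpha> \<beta>
  proof -
    have \<alpha>: "\<alpha> \<in> forms_set M" using that(1) by (simp add: Forms_part_def Forms_def)
    show ?thesis
    proof (rule form_eqI)
      show "(\<lambda>p vs. wedge (ext_deriv M \<alpha>) \<beta> p vs
          + form_scale (sign (j * 1)) (wedge \<alpha> (ext_deriv M \<beta>)) p vs) \<in> forms_set M"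
        using \<alpha> that(2) by (intro add_form form_scale_form wedge_form ext_deriv_form)
      show "ext_deriv M (wedge \<alpha> \<beta>) \<in> forms_set M"
        using \<alpha> that(2) by (intro wedge_form ext_deriv_form)
    next
      fix p c vs assume "c \<in> atlas M" "p \<in> fst c" "set vs \<subseteq> tangent_space M p"
      from ext_deriv_wedge[OF \<alpha> that(2) this]
      show "ext_deriv M (wedge \<alpha> \<beta>) p vs = wedge (ext_deriv M \<alpha>) \<beta> p vs
          + form_scale (sign (j * 1)) (wedge \<alpha> (ext_deriv M \<beta>)) p vs"
        by (simp add: wedge_shuffle_prod form_parity[OF that(1)] shuffle_prod_cmult_left form_scale_def)
    qed
  qed
  ultimately show ?thesis
    using ext_deriv_Forms_part unfolding Der_part_def carr
    by (simp add: Forms_def)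
qed

text \<open>Elements of \<open>Der M\<close> are presented as an even plus an odd derivation; zero
  supplies the even part of d.\<close>

lemma zero_in_Der_part: "(\<lambda>\<omega>\<in>carrier (Forms M). \<zero>\<^bsub>Forms M\<^esub>) \<in> Der_part M i"
proof -
  have "wedge (\<lambda>p vs. 0) \<beta> = (\<lambda>p vs. 0)" "wedge \<beta> (\<lambda>p vs. 0) = (\<lambda>p vs. 0)" for \<beta> :: "('m, 'a) form"
    by (simp_all add: wedge_def)
  then show ?thesis
    by (auto simp: Der_part_def Forms_part_def Forms_def zero_form add_form wedge_form form_scale_form
        form_scale_def[of _ "\<lambda>p vs. 0"])
qed

lemma ext_deriv_in_Der: "ext_deriv M \<in> carrier (Der M)"
proof -
  have "ext_deriv M = (\<lambda>\<omega>\<in>carrier (Forms M).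
      (\<lambda>\<omega>\<in>carrier (Forms M). \<zero>\<^bsub>Forms M\<^esub>) \<omega> \<oplus>\<^bsub>Forms M\<^esub> ext_deriv M \<omega>)"
    by (auto simp: fun_eq_iff ext_deriv_def Forms_def)
  then show ?thesis
    using zero_in_Der_part[of 0] ext_deriv_in_Der_part unfolding Der_def
    by (simp only: partial_object.simps mem_Collect_eq) blast
qed

end

section \<open>Homomorphisms on a tensor product\<close>

lemma hom_tensor_module:
  fixes R :: "'r ring" and A :: "('r, 'a) module" and B :: "('r, 'b) module"
  defines "Q \<equiv> free_Abelian_group (carrier A \<times> carrier B) Mod tensor_kernel R A B"
  shows "hom (add_monoid (tensor_module R A B)) (add_monoid (tensor_module R A B)) = hom Q Q"
  by (simp add: hom_def tensor_module_def Let_def Q_def)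

text \<open>Closure of A and B under their operations places the relations in the free abelian
  group, so that they generate a subgroup; commutativity makes it normal.\<close>

lemma tensor_kernel_normal:
  assumes "\<And>a a'. a \<in> carrier A \<Longrightarrow> a' \<in> carrier A \<Longrightarrow> a \<oplus>\<^bsub>A\<^esub> a' \<in> carrier A"
    and "\<And>b b'. b \<in> carrier B \<Longrightarrow> b' \<in> carrier B \<Longrightarrow> b \<oplus>\<^bsub>B\<^esub> b' \<in> carrier B"
    and "\<And>r a. r \<in> carrier R \<Longrightarrow> a \<in> carrier A \<Longrightarrow> r \<odot>\<^bsub>A\<^esub> a \<in> carrier A"
    and "\<And>r b. r \<in> carrier R \<Longrightarrow> b \<in> carrier B \<Longrightarrow> r \<odot>\<^bsub>B\<^esub> b \<in> carrier B"
  shows "tensor_kernel R A B \<lhd> free_Abelian_group (carrier A \<times> carrier B)"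
proof -
  let ?S = "carrier A \<times> carrier B"
  have diff: "x - y \<in> carrier (free_Abelian_group ?S)"
    if "x \<in> carrier (free_Abelian_group ?S)" "y \<in> carrier (free_Abelian_group ?S)" for x y
    using that keys_diff[of x y] by auto
  have "tensor_relations R A B \<subseteq> carrier (free_Abelian_group ?S)"
    unfolding tensor_relations_def using assms
    by (auto simp del: carrier_free_Abelian_group_iff intro!: diff)
  then have "subgroup (tensor_kernel R A B) (free_Abelian_group ?S)"
    unfolding tensor_kernel_def by (intro group.generate_is_subgroup) simp_all
  then show ?thesis
    by (rule comm_group.subgroup_imp_normal[OF abelian_free_Abelian_group])
qed

text \<open>Precomposed with the projection to the quotient, both maps are homomorphisms on the free
  abelian group that agree on its generators.\<close>

lemma tensor_hom_eqI:
  assumes normal: "tensor_kernel R A B \<lhd> free_Abelian_group (carrier A \<times> carrier B)"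
    and h: "h \<in> hom (add_monoid (tensor_module R A B)) (add_monoid (tensor_module R A B))"
    and h': "h' \<in> hom (add_monoid (tensor_module R A B)) (add_monoid (tensor_module R A B))"
    and eq: "\<And>a b. a \<in> carrier A \<Longrightarrow> b \<in> carrier B \<Longrightarrow>
      h (tensor_class R A B (frag_of (a, b))) = h' (tensor_class R A B (frag_of (a, b)))"
    and X: "X \<in> carrier (tensor_module R A B)"
  shows "h X = h' X"
proof -
  let ?S = "carrier A \<times> carrier B"
  let ?G = "free_Abelian_group ?S"
  let ?H = "?G Mod tensor_kernel R A B"
  let ?\<pi> = "tensor_class R A B"
  have \<pi>: "?\<pi> \<in> hom ?G ?H"
    using normal.r_coset_hom_Mod[OF normal] unfolding tensor_class_def .
  have gh: "group_hom ?G ?H (g \<circ> ?\<pi>)" if "g \<in> hom ?H ?H" for g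
    using hom_compose[OF \<pi> that] normal.factorgroup_is_group[OF normal]
    by (simp add: group_hom_def group_hom_axioms_def)
  interpret h: group_hom ?G ?H "h \<circ> ?\<pi>" by (rule gh[OF h[unfolded hom_tensor_module]])
  interpret h': group_hom ?G ?H "h' \<circ> ?\<pi>" by (rule gh[OF h'[unfolded hom_tensor_module]])
  have "(h \<circ> ?\<pi>) x = (h' \<circ> ?\<pi>) x" if "Poly_Mapping.keys x \<subseteq> ?S" for x
  proof (rule free_Abelian_group_induct[OF that])
    show "(h \<circ> ?\<pi>) 0 = (h' \<circ> ?\<pi>) 0"
      using h.hom_one h'.hom_one by simp
  next
    fix x y assume xy: "Poly_Mapping.keys x \<subseteq> ?S" "Poly_Mapping.keys y \<subseteq> ?S"
      "(h \<circ> ?\<pi>) x = (h' \<circ> ?\<pi>) x" "(h \<circ> ?\<pi>) y = (h' \<circ> ?\<pi>) y"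
    \<comment> \<open>The induction principle builds elements by differences, so inverses in the
      quotient have to be preserved as well.\<close>
    have diff: "(g \<circ> ?\<pi>) (x - y) = (g \<circ> ?\<pi>) x \<otimes>\<^bsub>?H\<^esub> inv\<^bsub>?H\<^esub> (g \<circ> ?\<pi>) y"
      if "group_hom ?G ?H (g \<circ> ?\<pi>)" for g
      using group_hom.hom_mult[OF that, of x "- y"] group_hom.hom_inv[OF that, of y] xy(1,2)
      by (simp del: comp_apply)
    show "(h \<circ> ?\<pi>) (x - y) = (h' \<circ> ?\<pi>) (x - y)"
      unfolding diff[OF h.group_hom_axioms] diff[OF h'.group_hom_axioms] xy(3,4) ..
  next
    fix a assume "a \<in> ?S"
    then show "(h \<circ> ?\<pi>) (frag_of a) = (h' \<circ> ?\<pi>) (frag_of a)" using eq by auto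
  qed
  moreover obtain x where "Poly_Mapping.keys x \<subseteq> ?S" "X = ?\<pi> x"
    using X by (auto simp: tensor_module_def Let_def FactGroup_def RCOSETS_def tensor_class_def)
  ultimately show ?thesis by simp
qed

section \<open>Smooth sections and the module of bundle-valued forms\<close>

lemma supervector_bundle_fibre:
  "supervector_bundle M E \<Longrightarrow> p \<in> points M \<Longrightarrow> module real_ring (fibre E p)"
  by (simp add: supervector_bundle_def)

lemma supervector_bundle_triv:
  assumes E: "supervector_bundle M E" and t: "(U, \<Phi>) \<in> trivs E"
  shows "openin (mtop M) U"
    and "p \<in> U \<Longrightarrow> u \<in> carrier (fibre E p) \<Longrightarrow> v \<in> carrier (fibre E p) \<Longrightarrow>
      \<Phi> p (u \<oplus>\<^bsub>fibre E p\<^esub> v) = \<Phi> p u + \<Phi> p v"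
    and "p \<in> U \<Longrightarrow> u \<in> carrier (fibre E p) \<Longrightarrow> \<Phi> p (r \<odot>\<^bsub>fibre E p\<^esub> u) = r *\<^sub>R \<Phi> p u"
proof -
  note triv = E[unfolded supervector_bundle_def, THEN conjunct2, THEN conjunct2, THEN conjunct2,
      THEN conjunct2, THEN conjunct1, THEN bspec, OF t, unfolded prod.case]
  show "openin (mtop M) U" using triv by (rule conjunct1)
  note fib = triv[THEN conjunct2, THEN bspec, THEN conjunct2]
  show "\<Phi> p (u \<oplus>\<^bsub>fibre E p\<^esub> v) = \<Phi> p u + \<Phi> p v"
    if "p \<in> U" "u \<in> carrier (fibre E p)" "v \<in> carrier (fibre E p)"
    using fib[OF that(1), THEN conjunct1, THEN bspec, OF that(2), THEN bspec, OF that(3)] .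
  show "\<Phi> p (r \<odot>\<^bsub>fibre E p\<^esub> u) = r *\<^sub>R \<Phi> p u" if "p \<in> U" "u \<in> carrier (fibre E p)"
    using fib[OF that(1), THEN conjunct2, THEN conjunct1, THEN spec, THEN bspec, OF that(2)] .
qed

context smooth_mfd
begin

text \<open>Trivialisations are additive on fibres, so locally the sum is one of smooth
  vector-valued functions. Closure of the sections is needed for the relations of the tensor product
  to lie in the free group.\<close>

lemma sections_add:
  assumes E: "supervector_bundle M E"
    and s: "s \<in> carrier (Sections M E)" and t: "t \<in> carrier (Sections M E)"
  shows "s \<oplus>\<^bsub>Sections M E\<^esub> t \<in> carrier (Sections M E)"
proof -
  note fibre = supervector_bundle_fibre[OF E]
  have st: "s p \<in> carrier (fibre E p)" "t p \<in> carrier (fibre E p)" if "p \<in> points M" for p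
    using s t that by (auto simp: Sections_def)
  have "manifold_smooth_on M U (\<lambda>p. \<Phi> p ((\<lambda>p\<in>points M. s p \<oplus>\<^bsub>fibre E p\<^esub> t p) p))"
    if triv: "(U, \<Phi>) \<in> trivs E" for U \<Phi>
    unfolding manifold_smooth_on_def
  proof
    fix c assume c: "c \<in> atlas M"
    interpret relatively_open V "snd c ` (fst c \<inter> U)"
      by (rule relatively_open_chart_image[OF c supervector_bundle_triv(1)[OF E triv]])
    have "smooth_on V (snd c ` (fst c \<inter> U)) ((\<lambda>p. \<Phi> p (s p)) \<circ> chart_inv c)"
      "smooth_on V (snd c ` (fst c \<inter> U)) ((\<lambda>p. \<Phi> p (t p)) \<circ> chart_inv c)"
      using s t triv c by (auto simp: Sections_def manifold_smooth_on_def)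
    then have "smooth_on V (snd c ` (fst c \<inter> U)) (\<lambda>x. ((\<lambda>p. \<Phi> p (s p)) \<circ> chart_inv c) x + ((\<lambda>p. \<Phi> p (t p)) \<circ> chart_inv c) x)"
      by (rule smooth_on_add)
    then show "smooth_on V (snd c ` (fst c \<inter> U))
        ((\<lambda>p. \<Phi> p ((\<lambda>p\<in>points M. s p \<oplus>\<^bsub>fibre E p\<^esub> t p) p)) \<circ> chart_inv c)"
    proof (rule smooth_on_cong)
      fix x assume "x \<in> snd c ` (fst c \<inter> U)"
      then obtain p where p: "x = snd c p" "p \<in> fst c" "p \<in> U" by auto
      then have "p \<in> points M" using chart_subset[OF c] by blast
      moreover have "\<Phi> p (s p \<oplus>\<^bsub>fibre E p\<^esub> t p) = \<Phi> p (s p) + \<Phi> p (t p)"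
        using supervector_bundle_triv(2)[OF E triv p(3)] st[OF \<open>p \<in> points M\<close>] by blast
      ultimately show "((\<lambda>p. \<Phi> p (s p)) \<circ> chart_inv c) x + ((\<lambda>p. \<Phi> p (t p)) \<circ> chart_inv c) x
          = ((\<lambda>p. \<Phi> p ((\<lambda>p\<in>points M. s p \<oplus>\<^bsub>fibre E p\<^esub> t p) p)) \<circ> chart_inv c) x"
        using p c by (simp add: chart_inv_left)
    qed
  qed
  moreover have "s p \<oplus>\<^bsub>fibre E p\<^esub> t p \<in> carrier (fibre E p)" if "p \<in> points M" for p
    using st[OF that]
    by (meson abelian_group.axioms(1) abelian_monoid.a_closed fibre module.axioms(2) that)
  ultimately show ?thesis by (auto simp: Sections_def)
qed

lemma sections_smult:
  assumes E: "supervector_bundle M E"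
    and f: "f \<in> carrier (Cinf M)" and s: "s \<in> carrier (Sections M E)"
  shows "f \<odot>\<^bsub>Sections M E\<^esub> s \<in> carrier (Sections M E)"
proof -
  note fibre = supervector_bundle_fibre[OF E]
  have sp: "s p \<in> carrier (fibre E p)" if "p \<in> points M" for p
    using s that by (auto simp: Sections_def)
  have "manifold_smooth_on M U (\<lambda>p. \<Phi> p ((\<lambda>p\<in>points M. f p \<odot>\<^bsub>fibre E p\<^esub> s p) p))"
    if triv: "(U, \<Phi>) \<in> trivs E" for U \<Phi>
    unfolding manifold_smooth_on_def
  proof
    fix c assume c: "c \<in> atlas M"
    interpret relatively_open V "snd c ` (fst c \<inter> U)"
      by (rule relatively_open_chart_image[OF c supervector_bundle_triv(1)[OF E triv]])
    have "smooth_on V (snd c ` (fst c \<inter> points M)) (f \<circ> chart_inv c)"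
      using f c by (simp add: Cinf_def manifold_smooth_on_def)
    then have "smooth_on V (snd c ` (fst c \<inter> U)) (f \<circ> chart_inv c)"
      by (rule smooth_on_subset) (use chart_subset[OF c] in blast)
    moreover have "smooth_on V (snd c ` (fst c \<inter> U)) ((\<lambda>p. \<Phi> p (s p)) \<circ> chart_inv c)"
      using s triv c by (auto simp: Sections_def manifold_smooth_on_def)
    ultimately have "smooth_on V (snd c ` (fst c \<inter> U)) (\<lambda>x. (f \<circ> chart_inv c) x *\<^sub>R ((\<lambda>p. \<Phi> p (s p)) \<circ> chart_inv c) x)"
      by (rule smooth_on_scaleR)
    then show "smooth_on V (snd c ` (fst c \<inter> U))
        ((\<lambda>p. \<Phi> p ((\<lambda>p\<in>points M. f p \<odot>\<^bsub>fibre E p\<^esub> s p) p)) \<circ> chart_inv c)"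
    proof (rule smooth_on_cong)
      fix x assume "x \<in> snd c ` (fst c \<inter> U)"
      then obtain p where p: "x = snd c p" "p \<in> fst c" "p \<in> U" by auto
      then have "p \<in> points M" using chart_subset[OF c] by blast
      moreover have "\<Phi> p (f p \<odot>\<^bsub>fibre E p\<^esub> s p) = f p *\<^sub>R \<Phi> p (s p)"
        using supervector_bundle_triv(3)[OF E triv p(3)] sp[OF \<open>p \<in> points M\<close>] by blast
      ultimately show "(f \<circ> chart_inv c) x *\<^sub>R ((\<lambda>p. \<Phi> p (s p)) \<circ> chart_inv c) x
          = ((\<lambda>p. \<Phi> p ((\<lambda>p\<in>points M. f p \<odot>\<^bsub>fibre E p\<^esub> s p) p)) \<circ> chart_inv c) x"
        using p c by (simp add: chart_inv_left)
    qed
  qed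
  moreover have "f p \<odot>\<^bsub>fibre E p\<^esub> s p \<in> carrier (fibre E p)" if "p \<in> points M" for p
    using module.smult_closed[OF fibre[OF that]] sp[OF that] by (simp add: real_ring_def)
  ultimately show ?thesis by (auto simp: Sections_def)
qed

lemma EForms_kernel_normal:
  assumes "supervector_bundle M E"
  shows "tensor_kernel (Cinf M) (Forms M) (Sections M E)
    \<lhd> free_Abelian_group (carrier (Forms M) \<times> carrier (Sections M E))"
proof (rule tensor_kernel_normal)
  show "\<alpha> \<oplus>\<^bsub>Forms M\<^esub> \<beta> \<in> carrier (Forms M)"
    if "\<alpha> \<in> carrier (Forms M)" "\<beta> \<in> carrier (Forms M)" for \<alpha> \<beta>
    using that by (simp add: Forms_def add_form)
  show "f \<odot>\<^bsub>Forms M\<^esub> \<alpha> \<in> carrier (Forms M)"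
    if "f \<in> carrier (Cinf M)" "\<alpha> \<in> carrier (Forms M)" for f \<alpha>
    using that by (simp add: Forms_def smult_form)
qed (rule sections_add[OF assms] sections_smult[OF assms]; assumption)+

end

section \<open>The superconnection induced by a graded connection\<close>

text \<open>Well-definedness of the formula on decomposable elements is expressed as unique
  existence of an additive operator extending it.\<close>

theorem theorem6p1:
  fixes M :: "('m, 'a::euclidean_space) manifold"
    and E :: "('m, 'e, 'f::euclidean_space) svbundle"
  assumes "smooth_manifold M"
    and "supervector_bundle M E"
    and "graded_connection M E nab"
  shows "(\<exists>!D. induced_operator M E nab D) \<and>
    (\<forall>D. induced_operator M E nab D \<longrightarrow> quillen_superconnection M E D)"
proof -
  interpret smooth_mfd M using assms(1) by unfold_locales
  let ?L = "EForms M E" and ?D = "nab (ext_deriv M)"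
  have End: "?D \<in> carrier (End_real M ?L)"
    using assms(3) ext_deriv_in_Der by (auto simp: graded_connection_def Let_def)
  have hom: "?D \<in> hom (add_monoid ?L) (add_monoid ?L)"
    using End by (auto simp: End_real_def hom_def)
  have ext: "?D \<in> extensional (carrier ?L)"
    using End by (auto simp: End_real_def PiE_def)
  \<comment> \<open>The connection at d is already an additive operator on the whole module, so no
    extension from decomposable elements has to be constructed.\<close>
  have ind: "induced_operator M E nab ?D"
    using ext hom by (simp add: induced_operator_def Let_def)
  have unique: "D = ?D" if "induced_operator M E nab D" for D
  proof
    fix X
    have D: "D \<in> extensional (carrier ?L)" "D \<in> hom (add_monoid ?L) (add_monoid ?L)"
      "\<And>\<alpha> \<phi>. \<alpha> \<in> carrier (Forms M) \<Longrightarrow> \<phi> \<in> carrier (Sections M E) \<Longrightarrow>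
        D (tensor M E \<alpha> \<phi>) = ?D (tensor M E \<alpha> \<phi>)"
      using that by (auto simp: induced_operator_def Let_def)
    show "D X = ?D X"
    proof (cases "X \<in> carrier ?L")
      case True
      show ?thesis
        using tensor_hom_eqI[OF EForms_kernel_normal[OF assms(2)], folded EForms_def, OF D(2) hom] D(3) True
        by (simp add: tensor_def)
    next
      case False
      then show ?thesis
        using extensional_arb[OF D(1)] extensional_arb[OF ext] by metis
    qed
  qed
  have "\<forall>i j. \<forall>\<delta>\<in>Der_part M i. \<forall>x\<in>EForms_part M E j. nab \<delta> x \<in> EForms_part M E (i + j)"
    using assms(3) by (simp add: graded_connection_def Let_def)
  then have odd: "?D x \<in> EForms_part M E (j + 1)" if "x \<in> EForms_part M E j" for j x
    using ext_deriv_in_Der_part that unfolding add.commute[of j 1] by blast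
  have "\<forall>i j. \<forall>\<delta>\<in>Der_part M i. \<forall>\<alpha>\<in>Forms_part M j. \<forall>x\<in>carrier ?L. nab \<delta> (\<alpha> \<odot>\<^bsub>?L\<^esub> x) =
      \<delta> \<alpha> \<odot>\<^bsub>?L\<^esub> x \<oplus>\<^bsub>?L\<^esub> real_scale M ?L (sign (j * i)) (\<alpha> \<odot>\<^bsub>?L\<^esub> nab \<delta> x)"
    using assms(3) by (simp add: graded_connection_def Let_def)
  \<comment> \<open>For d the degree i is 1, and \<open>sign (j * i)\<close> becomes the sign
    \<open>sign j\<close> of the superconnection rule.\<close>
  from this[THEN spec, THEN spec, THEN bspec, OF ext_deriv_in_Der_part]
  have "quillen_superconnection M E ?D"
    using End odd by (simp add: quillen_superconnection_def Let_def)
  then show ?thesis using ind unique by blast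
qed

end
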